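(* Let $X=\{x,y\}$ and $A=K\{X\}$ (or $A=K\{\{X\}\}$), with $K$ a field of characteristic $0$. A vector space basis of $A_0=\operatorname{im}\Phi=\operatorname{im}(\Phi_2\circ\Phi_1)$ is given by all $\Phi(s)$, $s\in\Gamma$, where $$\Gamma=\{s_1s_2\in M(x,y):\deg s_1\geq 2,\ \deg s_2\geq 1\}\cup\{y\cdot(x\cdot t)\in M(x,y):\deg t\geq 0\}$$ (in the second set $t=1$ is allowed, giving $y\cdot x$).
   Context: $M(x,y)$ is the free magma (without unit) on $\{x,y\}$ (planar binary rooted trees with leaves labeled $x$ or $y$); $\deg$ is the number of leaves, and $1$ (the empty tree) has degree $0$. $K\{X\}$ is the free unital, not necessarily associative, algebra on $x,y$ with basis $M(x,y)\cup\{1\}$, graded by $\deg$, and $K\{\{X\}\}=\prod_n K\{X\}_n$ is its completion. $\frac{d}{dx},\frac{d}{dy}$ are the $K$-linear derivations of $A$ with $\frac{d}{dx}x=1,\frac{d}{dx}y=0$, $\frac{d}{dy}y=1,\frac{d}{dy}x=0$. $A_0=\{f\in A:\frac{d}{dx}f=\frac{d}{dy}f=0\}$. $L_1,L_2$ denote left multiplication by $x$ and by $y$, respectively. Every $f\in A$ has a unique expansion $f=\sum_j L_1^j(b_j)$ with $\frac{d}{dx}b_j=0$ for all $j$; $\Phi_1(f):=b_0$. Likewise $\Phi_2(f):=b'_0$, where $f=\sum_j L_2^j(b'_j)$ is the unique expansion with $\frac{d}{dy}b'_j=0$ for all $j$. Every $f\in A$ has a unique total Taylor expansion $f=\sum_{(j_1,j_2)}L_1^{j_1}L_2^{j_2}(a_{(j_1,j_2)})$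 with all $a_{(j_1,j_2)}\in A_0$, and $\Phi:A\to A_0$ is the projector $f\mapsto a_{(0,0)}$; $\Phi=\Phi_2\circ\Phi_1$.
   Formalization: The unit 1 lies in A_0 but not in the span of Φ(Γ), so the basis is Φ(s) for s in Γ together with s=1; for K{{X}}, where A_0 has uncountable dimension, "basis" means unique, possibly infinite, linear combinations. *)

theory Defs
  imports Complex_Main "HOL-Library.Function_Algebras" "HOL-Library.Groups_Big_Fun"
begin

datatype letter = LX | LY

text \<open>\<open>tree\<close> is the free magma \<open>M(x,y)\<close> without unit; in \<open>mon\<close>, \<open>None\<close> is the empty tree \<open>1\<close>.\<close>

datatype tree = Leaf letter | Node tree tree

type_synonym mon = "tree option"

primrec leaves :: "tree \<Rightarrow> nat" where
  "leaves (Leaf a) = 1"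
| "leaves (Node s t) = leaves s + leaves t"

definition deg :: "mon \<Rightarrow> nat" where
  "deg u = (case u of None \<Rightarrow> 0 | Some t \<Rightarrow> leaves t)"

abbreviation letter_mon :: "letter \<Rightarrow> mon" where
  "letter_mon a \<equiv> Some (Leaf a)"

fun mon_mult :: "mon \<Rightarrow> mon \<Rightarrow> mon"  (infixr "\<odot>" 70) where
  "None \<odot> v = v"
| "Some s \<odot> None = Some s"
| "Some s \<odot> Some t = Some (Node s t)"

text \<open>
  There are finitely many trees of each degree, so \<open>K{{X}}\<close> is the space of all functions
  \<open>mon \<Rightarrow> K\<close>, and \<open>K{X}\<close> is the subspace of finitely supported functions. Addition is
  pointwise; the pointwise product \<open>*\<close> and the constant function \<open>1\<close> on this type
  are not the product and unit of the algebra, which are \<open>\<star>\<close> and \<open>mon_ser None\<close>.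
\<close>

type_synonym 'k ser = "mon \<Rightarrow> 'k"

definition scale :: "'k::field \<Rightarrow> 'k ser \<Rightarrow> 'k ser" where
  "scale c f = (\<lambda>u. c * f u)"

global_interpretation ser: vector_space scale
  by unfold_locales (auto simp: scale_def fun_eq_iff algebra_simps)

definition mon_ser :: "mon \<Rightarrow> 'k::field ser" where
  "mon_ser s = (\<lambda>u. if u = s then 1 else 0)"

text \<open>The index set of this sum is finite, see \<open>finite_factorizations\<close> below.\<close>

definition ser_mult :: "'k::field ser \<Rightarrow> 'k ser \<Rightarrow> 'k ser"  (infixl "\<star>" 70) where
  "f \<star> g = (\<lambda>u. \<Sum>(p, q) | p \<odot> q = u. f p * g q)"

datatype kind = Free | Completed

primrec alg :: "kind \<Rightarrow> 'k::field ser set" where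
  "alg Free = {f. finite {u. f u \<noteq> 0}}"
| "alg Completed = UNIV"

text \<open>
  In \<open>K{X}\<close> only finite sums are admitted. In \<open>K{{X}}\<close> a family is summable if each
  coefficient is affected by only finitely many members, that is, if it is summable
  for the product topology of the discrete spaces \<open>K{X}\<^sub>n\<close>.
\<close>

primrec summable_in :: "kind \<Rightarrow> ('i \<Rightarrow> 'k::field ser) \<Rightarrow> bool" where
  "summable_in Free F \<longleftrightarrow> finite {i. F i \<noteq> 0}"
| "summable_in Completed F \<longleftrightarrow> (\<forall>u. finite {i. F i u \<noteq> 0})"

definition ser_sum :: "('i \<Rightarrow> 'k::field ser) \<Rightarrow> 'k ser" where
  "ser_sum F = (\<lambda>u. Sum_any (\<lambda>i. F i u))"

definition Lmul :: "letter \<Rightarrow> 'k::field ser \<Rightarrow> 'k ser" where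
  "Lmul a f = mon_ser (letter_mon a) \<star> f"

text \<open>
  The derivation \<open>d/da\<close> is given on trees by the Leibniz rule and extended to series
  coefficientwise, each sum being finite because \<open>d/da\<close> lowers the degree by one.
  On \<open>K{{X}}\<close> this is the continuous derivation, see \<open>ser_deriv_mult\<close> below.
\<close>

primrec tree_deriv :: "letter \<Rightarrow> tree \<Rightarrow> 'k::field ser" where
  "tree_deriv a (Leaf b) = (if b = a then mon_ser None else 0)"
| "tree_deriv a (Node s t) =
     tree_deriv a s \<star> mon_ser (Some t) + mon_ser (Some s) \<star> tree_deriv a t"

definition mon_deriv :: "letter \<Rightarrow> mon \<Rightarrow> 'k::field ser" where
  "mon_deriv a s = (case s of None \<Rightarrow> 0 | Some t \<Rightarrow> tree_deriv a t)"

definition ser_deriv :: "letter \<Rightarrow> 'k::field ser \<Rightarrow> 'k ser" where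
  "ser_deriv a f = (\<lambda>u. Sum_any (\<lambda>s. f s * mon_deriv a s u))"

definition A0 :: "kind \<Rightarrow> 'k::field ser set" where
  "A0 k = {f \<in> alg k. ser_deriv LX f = 0 \<and> ser_deriv LY f = 0}"

definition partial_expansion ::
  "kind \<Rightarrow> letter \<Rightarrow> 'k::field ser \<Rightarrow> (nat \<Rightarrow> 'k ser) \<Rightarrow> bool" where
  "partial_expansion k a f b \<longleftrightarrow>
     (\<forall>j. b j \<in> alg k \<and> ser_deriv a (b j) = 0) \<and>
     summable_in k (\<lambda>j. (Lmul a ^^ j) (b j)) \<and>
     f = ser_sum (\<lambda>j. (Lmul a ^^ j) (b j))"

text \<open>\<open>partial_Phi k LX\<close> is \<open>\<Phi>\<^sub>1\<close> and \<open>partial_Phi k LY\<close> is \<open>\<Phi>\<^sub>2\<close>.\<close>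

definition partial_Phi :: "kind \<Rightarrow> letter \<Rightarrow> 'k::field ser \<Rightarrow> 'k ser" where
  "partial_Phi k a f = (THE b. partial_expansion k a f b) 0"

definition total_expansion ::
  "kind \<Rightarrow> 'k::field ser \<Rightarrow> (nat \<times> nat \<Rightarrow> 'k ser) \<Rightarrow> bool" where
  "total_expansion k f c \<longleftrightarrow>
     (\<forall>j. c j \<in> A0 k) \<and>
     summable_in k (\<lambda>(j1, j2). (Lmul LX ^^ j1) ((Lmul LY ^^ j2) (c (j1, j2)))) \<and>
     f = ser_sum (\<lambda>(j1, j2). (Lmul LX ^^ j1) ((Lmul LY ^^ j2) (c (j1, j2))))"

definition Phi :: "kind \<Rightarrow> 'k::field ser \<Rightarrow> 'k ser" where
  "Phi k f = (THE c. total_expansion k f c) (0, 0)"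

text \<open>
  \<open>Gamma\<close> has no element of degree \<open>0\<close>, while the unit \<open>1\<close> is annihilated by both derivations
  and fixed by \<open>\<Phi>\<close>. So \<open>Gamma\<close> indexes a basis of the constants without degree \<open>0\<close> part,
  and \<open>insert None Gamma\<close> one of all constants.
\<close>

definition Gamma :: "mon set" where
  "Gamma = {s1 \<odot> s2 | s1 s2. deg s1 \<ge> 2 \<and> deg s2 \<ge> 1} \<union>
           {letter_mon LY \<odot> (letter_mon LX \<odot> t) | t. deg t \<ge> 0}"

text \<open>
  Basis of a subspace \<open>V\<close> given by a family \<open>v\<close> indexed by \<open>I\<close>. In \<open>K{X}\<close> this is a
  vector space basis. In \<open>K{{X}}\<close> it is a basis in the topological sense: all families of
  coefficients are admitted, and every element of \<open>V\<close> is a unique, possibly infinite,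
  linear combination. (The constants of \<open>K{{X}}\<close> have uncountable dimension, so no
  countable family is a Hamel basis.)
\<close>

primrec is_basis :: "kind \<Rightarrow> 'i set \<Rightarrow> ('i \<Rightarrow> 'k::field ser) \<Rightarrow> 'k ser set \<Rightarrow> bool" where
  "is_basis Free I v V \<longleftrightarrow>
     inj_on v I \<and> ser.independent (v ` I) \<and> ser.span (v ` I) = V"
| "is_basis Completed I v V \<longleftrightarrow>
     (\<forall>c. (\<forall>i. i \<notin> I \<longrightarrow> c i = 0) \<longrightarrow>
        summable_in Completed (\<lambda>i. scale (c i) (v i)) \<and>
        ser_sum (\<lambda>i. scale (c i) (v i)) \<in> V) \<and>
     (\<forall>f\<in>V. \<exists>!c. (\<forall>i. i \<notin> I \<longrightarrow> c i = 0) \<and> f = ser_sum (\<lambda>i. scale (c i) (v i)))"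

subsection \<open>Well-definedness of the product and of the derivations\<close>

lemma deg_simps [simp]:
  "deg None = 0" "deg (Some t) = leaves t"
  by (simp_all add: deg_def)

lemma deg_mon_mult [simp]: "deg (p \<odot> q) = deg p + deg q"
  by (induction p q rule: mon_mult.induct) auto

lemma leaves_pos [simp]: "leaves t > 0"
  by (induction t) auto

lemma finite_leaves: "finite {t. leaves t \<le> n}"
proof (induction n)
  case (Suc n)
  let ?T = "{t. leaves t \<le> n}"
  have "{t. leaves t \<le> Suc n} \<subseteq> {Leaf LX, Leaf LY} \<union> (\<lambda>(s, t). Node s t) ` (?T \<times> ?T)"
  proof
    fix t assume "t \<in> {t. leaves t \<le> Suc n}"
    then show "t \<in> {Leaf LX, Leaf LY} \<union> (\<lambda>(s, t). Node s t) ` (?T \<times> ?T)"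
    proof (cases t)
      case (Leaf a) then show ?thesis by (cases a) auto
    next
      case (Node p q)
      have "leaves p > 0" "leaves q > 0" by (rule leaves_pos)+
      with Node \<open>t \<in> _\<close> have "leaves p \<le> n" "leaves q \<le> n"
        by (auto simp del: leaves_pos)
      with Node show ?thesis by auto
    qed
  qed
  with Suc show ?case by (meson finite.emptyI finite.insertI finite_SigmaI finite_UnI finite_imageI finite_subset)
qed (simp add: leaves_pos[THEN less_imp_neq, symmetric])

lemma finite_deg: "finite {s. deg s \<le> n}"
proof -
  have "{s. deg s \<le> n} \<subseteq> insert None (Some ` {t. leaves t \<le> n})"
  proof
    fix s assume "s \<in> {s. deg s \<le> n}"
    then show "s \<in> insert None (Some ` {t. leaves t \<le> n})" by (cases s) auto
  qed
  then show ?thesis using finite_leaves by (meson finite.insertI finite_imageI finite_subset)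
qed

lemma finite_factorizations: "finite {(p, q). p \<odot> q = u}"
proof (rule finite_subset)
  show "{(p, q). p \<odot> q = u} \<subseteq> {s. deg s \<le> deg u} \<times> {s. deg s \<le> deg u}" by auto
qed (simp add: finite_deg)

lemma tree_deriv_deg: "tree_deriv a t u \<noteq> (0::'k::field) \<Longrightarrow> leaves t = Suc (deg u)"
proof (induction t arbitrary: u)
  case (Leaf b)
  then show ?case by (auto simp: mon_ser_def split: if_splits)
next
  case (Node s t)
  from Node.prems consider "(tree_deriv a s \<star> mon_ser (Some t)) u \<noteq> (0::'k)"
    | "(mon_ser (Some s) \<star> tree_deriv a t) u \<noteq> (0::'k)" by force
  then show ?case
  proof cases
    case 1
    then obtain p q where "p \<odot> q = u" "tree_deriv a s p * mon_ser (Some t) q \<noteq> (0::'k)"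
      unfolding ser_mult_def by (auto elim!: sum.not_neutral_contains_not_neutral)
    with Node.IH(1)[of p] show ?thesis by (auto simp: mon_ser_def split: if_splits)
  next
    case 2
    then obtain p q where "p \<odot> q = u" "mon_ser (Some s) p * tree_deriv a t q \<noteq> (0::'k)"
      unfolding ser_mult_def by (auto elim!: sum.not_neutral_contains_not_neutral)
    with Node.IH(2)[of q] show ?thesis by (auto simp: mon_ser_def split: if_splits)
  qed
qed

lemma mon_deriv_deg: "mon_deriv a s u \<noteq> (0::'k::field) \<Longrightarrow> deg s = Suc (deg u)"
  by (cases s) (auto simp: mon_deriv_def dest: tree_deriv_deg)

lemma ser_deriv_eq_sum:
  assumes "finite B" "{s. deg s \<le> Suc (deg u)} \<subseteq> B"
  shows "ser_deriv a f u = (\<Sum>s\<in>B. f s * mon_deriv a s u)"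
  unfolding ser_deriv_def
proof (rule Sum_any.expand_superset[OF assms(1)])
  have "deg s \<le> Suc (deg u)" if "f s * mon_deriv a s u \<noteq> 0" for s
    using that by (auto dest!: mon_deriv_deg)
  with assms(2) show "{s. f s * mon_deriv a s u \<noteq> 0} \<subseteq> B" by blast
qed

lemma ser_deriv_add: "ser_deriv a (f + g) = ser_deriv a f + ser_deriv a g"
  by (rule ext)
    (simp add: ser_deriv_eq_sum[OF finite_deg order_refl] sum.distrib algebra_simps)

lemma ser_deriv_scale: "ser_deriv a (scale c f) = scale c (ser_deriv a f)"
  by (rule ext)
    (simp add: ser_deriv_eq_sum[OF finite_deg order_refl] scale_def sum_distrib_left algebra_simps)

lemma ser_deriv_letter:
  "ser_deriv a (mon_ser (letter_mon b)) = (if b = a then mon_ser None else 0)"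
proof (rule ext)
  fix u
  let ?B = "insert (letter_mon b) {s. deg s \<le> Suc (deg u)}"
  have "finite ?B" by (simp add: finite_deg)
  then have "ser_deriv a (mon_ser (letter_mon b)) u =
      (\<Sum>s\<in>?B. mon_ser (letter_mon b) s * mon_deriv a s u)"
    by (rule ser_deriv_eq_sum) auto
  also have "\<dots> = (\<Sum>s\<in>?B. if s = letter_mon b then mon_deriv a s u else 0)"
    by (rule sum.cong) (auto simp: mon_ser_def)
  also have "\<dots> = mon_deriv a (letter_mon b) u"
    using \<open>finite ?B\<close> by (subst sum.delta) auto
  finally show "ser_deriv a (mon_ser (letter_mon b)) u = (if b = a then mon_ser None else 0) u"
    by (simp add: mon_deriv_def)
qed

lemma one_ser_mult: "mon_ser None \<star> f = f" and ser_mult_one: "f \<star> mon_ser None = f"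
proof -
  have 1: "(mon_ser None \<star> f) u = f u" "(f \<star> mon_ser None) u = f u" for u
  proof -
    have "(mon_ser None \<star> f) u = (\<Sum>(p, q)\<in>{(None, u)}. mon_ser None p * f q)"
      unfolding ser_mult_def
      by (rule sum.mono_neutral_right[OF finite_factorizations])
        (auto simp: mon_ser_def split: if_splits)
    moreover have "u \<odot> None = u" by (cases u) auto
    then have "(f \<star> mon_ser None) u = (\<Sum>(p, q)\<in>{(u, None)}. f p * mon_ser None q)"
      unfolding ser_mult_def
      by (intro sum.mono_neutral_right[OF finite_factorizations])
        (auto simp: mon_ser_def split: if_splits, (metis mon_mult.simps option.exhaust)+)
    ultimately show "(mon_ser None \<star> f) u = f u" "(f \<star> mon_ser None) u = f u"
      by (simp_all add: mon_ser_def)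
  qed
  show "mon_ser None \<star> f = f" "f \<star> mon_ser None = f" by (auto simp: 1)
qed

lemma mon_deriv_mult:
  "mon_deriv a (p \<odot> q) = mon_deriv a p \<star> mon_ser q + mon_ser p \<star> mon_deriv a q"
proof -
  have z: "0 \<star> f = 0" "f \<star> 0 = 0" for f :: "'k::field ser"
    by (auto simp: ser_mult_def fun_eq_iff)
  show ?thesis
    by (cases "(p, q)" rule: mon_mult.cases)
      (auto simp: mon_deriv_def one_ser_mult ser_mult_one z)
qed

lemma ser_deriv_mult: "ser_deriv a (f \<star> g) = ser_deriv a f \<star> g + f \<star> ser_deriv a g"
proof (rule ext)
  fix u
  define B where "B = {s. deg s \<le> Suc (deg u)}"
  define U where "U = {(p, q). p \<odot> q = u}"
  have fB: "finite B" by (simp add: B_def finite_deg)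
  have fU: "finite U" by (simp add: U_def finite_factorizations)
  have dB: "ser_deriv a h p = (\<Sum>s\<in>B. h s * mon_deriv a s p)" if "deg p \<le> deg u" for h p
    by (rule ser_deriv_eq_sum[OF fB]) (use that in \<open>auto simp: B_def\<close>)
  have mB: "(h \<star> h') v = (\<Sum>p\<in>B. \<Sum>q\<in>B. if p \<odot> q = v then h p * h' q else 0)"
    if "v \<in> B" for h h' :: "'a ser" and v
  proof -
    have "(h \<star> h') v = (\<Sum>(p, q)\<in>{z\<in>B \<times> B. fst z \<odot> snd z = v}. h p * h' q)"
      unfolding ser_mult_def using that by (intro sum.cong) (auto simp: B_def)
    also have "\<dots> = (\<Sum>z\<in>B \<times> B. if fst z \<odot> snd z = v then h (fst z) * h' (snd z) else 0)"
      using fB by (subst sum.inter_filter) (auto simp: case_prod_beta intro!: sum.cong)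
    finally show ?thesis by (simp add: sum.cartesian_product case_prod_beta)
  qed
  have "ser_deriv a (f \<star> g) u =
      (\<Sum>s\<in>B. \<Sum>p\<in>B. \<Sum>q\<in>B. if p \<odot> q = s then f p * g q * mon_deriv a s u else 0)"
    by (auto simp: dB mB sum_distrib_right intro!: sum.cong)
  also have "\<dots> = (\<Sum>p\<in>B. \<Sum>q\<in>B. \<Sum>s\<in>B. if p \<odot> q = s then f p * g q * mon_deriv a s u else 0)"
    by (rule trans[OF sum.swap], rule sum.cong[OF refl], rule sum.swap)
  also have "\<dots> = (\<Sum>p\<in>B. \<Sum>q\<in>B. f p * g q * mon_deriv a (p \<odot> q) u)"
  proof (intro sum.cong refl)
    fix p q
    have "p \<odot> q \<in> B" if "mon_deriv a (p \<odot> q) u \<noteq> (0::'a)"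
      using mon_deriv_deg[OF that] by (simp add: B_def)
    then show "(\<Sum>s\<in>B. if p \<odot> q = s then f p * g q * mon_deriv a s u else 0) =
        f p * g q * mon_deriv a (p \<odot> q) u"
      using fB by (auto simp: sum.delta)
  qed
  also have "\<dots> = (\<Sum>p\<in>B. \<Sum>q\<in>B. f p * g q * (mon_deriv a p \<star> mon_ser q) u) +
      (\<Sum>p\<in>B. \<Sum>q\<in>B. f p * g q * (mon_ser p \<star> mon_deriv a q) u)"
    by (simp add: mon_deriv_mult sum.distrib algebra_simps)
  also have "(\<Sum>p\<in>B. \<Sum>q\<in>B. f p * g q * (mon_deriv a p \<star> mon_ser q) u) = (ser_deriv a f \<star> g) u"
  proof -
    have "(\<Sum>p\<in>B. \<Sum>q\<in>B. f p * g q * (mon_deriv a p \<star> mon_ser q) u) =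
        (\<Sum>p\<in>B. \<Sum>q\<in>B. \<Sum>(v, w)\<in>U. if w = q then f p * mon_deriv a p v * g q else 0)"
      by (intro sum.cong refl)
        (auto simp: ser_mult_def U_def mon_ser_def sum_distrib_left intro!: sum.cong)
    also have "\<dots> = (\<Sum>(v, w)\<in>U. \<Sum>p\<in>B. \<Sum>q\<in>B. if w = q then f p * mon_deriv a p v * g q else 0)"
      by (simp add: case_prod_beta sum.swap[where A = U])
    also have "\<dots> = (\<Sum>(v, w)\<in>U. ser_deriv a f v * g w)"
    proof (intro sum.cong refl, clarify)
      fix v w assume "(v, w) \<in> U"
      then have "w \<in> B" "deg v \<le> deg u" by (auto simp: U_def B_def)
      then show "(\<Sum>p\<in>B. \<Sum>q\<in>B. if w = q then f p * mon_deriv a p v * g q else 0) =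
          ser_deriv a f v * g w"
        using fB by (simp add: sum.delta' dB sum_distrib_right)
    qed
    finally show ?thesis by (simp add: ser_mult_def U_def)
  qed
  also have "(\<Sum>p\<in>B. \<Sum>q\<in>B. f p * g q * (mon_ser p \<star> mon_deriv a q) u) = (f \<star> ser_deriv a g) u"
  proof -
    have "(\<Sum>p\<in>B. \<Sum>q\<in>B. f p * g q * (mon_ser p \<star> mon_deriv a q) u) =
        (\<Sum>q\<in>B. \<Sum>p\<in>B. f p * g q * (mon_ser p \<star> mon_deriv a q) u)"
      by (rule sum.swap)
    also have "\<dots> =
        (\<Sum>q\<in>B. \<Sum>p\<in>B. \<Sum>(v, w)\<in>U. if v = p then f p * (g q * mon_deriv a q w) else 0)"
      by (intro sum.cong refl)
        (auto simp: ser_mult_def U_def mon_ser_def sum_distrib_left intro!: sum.cong)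
    also have "\<dots> =
        (\<Sum>(v, w)\<in>U. \<Sum>q\<in>B. \<Sum>p\<in>B. if v = p then f p * (g q * mon_deriv a q w) else 0)"
      by (simp add: case_prod_beta sum.swap[where A = U])
    also have "\<dots> = (\<Sum>(v, w)\<in>U. f v * ser_deriv a g w)"
    proof (intro sum.cong refl, clarify)
      fix v w assume "(v, w) \<in> U"
      then have "v \<in> B" "deg w \<le> deg u" by (auto simp: U_def B_def)
      then show "(\<Sum>q\<in>B. \<Sum>p\<in>B. if v = p then f p * (g q * mon_deriv a q w) else 0) =
          f v * ser_deriv a g w"
        using fB by (simp add: sum.delta' dB sum_distrib_left)
    qed
    finally show ?thesis by (simp add: ser_mult_def U_def)
  qed
  finally show "ser_deriv a (f \<star> g) u = (ser_deriv a f \<star> g + f \<star> ser_deriv a g) u" by simp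
qed

end

theory Submission
  imports Defs
begin

text \<open>
  Write \<open>D\<^sub>a\<close> for \<open>d/da\<close> and \<open>L\<^sub>a\<close> for left multiplication by the letter \<open>a\<close>. The proof uses three
  facts about them: \<open>D\<^sub>x\<close> and \<open>D\<^sub>y\<close> commute, \<open>D\<^sub>a L\<^sub>b = L\<^sub>b D\<^sub>a\<close> for \<open>a \<noteq> b\<close>, and
  \<open>D\<^sub>a L\<^sub>a = 1 + L\<^sub>a D\<^sub>a\<close>.
  
  The last relation, with \<open>D\<^sub>a\<close> lowering the degree and \<open>K\<close> of characteristic \<open>0\<close>, makes
  \<open>A = ker D\<^sub>a \<oplus> L\<^sub>a A\<close> for each letter \<open>a\<close>. The sum is direct because \<open>D\<^sub>a L\<^sub>a\<close> is injective
  (\<open>ser_deriv_Lmul_eq_0\<close>), and it is everything because \<open>g = \<Sum>\<^sub>i (-1)\<^sup>i/(i+1)! L\<^sub>a\<^sup>i D\<^sub>a\<^sup>i\<^sup>+\<^sup>1 f\<close> solves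
  \<open>D\<^sub>a L\<^sub>a g = D\<^sub>a f\<close> (\<open>ser_deriv_Lmul_taylor_quot\<close>). So every \<open>f\<close> has a unique remainder in \<open>ker D\<^sub>a\<close>
  and a unique quotient \<open>g\<close>, as in division by a letter. Iterating the division gives existence
  and uniqueness of the partial expansion, and doing so for \<open>x\<close> and then for \<open>y\<close> those of
  the total expansion. Hence \<open>\<Phi>\<^sub>1\<close> and \<open>\<Phi>\<^sub>2\<close> are the two remainder maps and \<open>\<Phi>\<close> is their composition.
  
  The kernel of \<open>\<Phi>\<close> is therefore \<open>L\<^sub>x A \<oplus> L\<^sub>y (ker D\<^sub>x)\<close>. Let \<open>V\<close> be the space of series supported on
  \<open>\<Gamma> \<union> {1}\<close>. The monomials outside of \<open>\<Gamma> \<union> {1}\<close> are \<open>x\<cdot>v\<close> for any \<open>v\<close>, and \<open>y\<cdot>v\<close> for \<open>v\<close> not of the form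
  \<open>x\<cdot>t\<close>. From \<open>L\<^sub>y A = L\<^sub>y L\<^sub>x A \<oplus> L\<^sub>y (ker D\<^sub>x)\<close> and \<open>L\<^sub>y L\<^sub>x A \<subseteq> V\<close> one reads off that \<open>V\<close> is a complement of the
  kernel of \<open>\<Phi>\<close>. So \<open>\<Phi>\<close> maps \<open>V\<close> isomorphically onto its image \<open>A\<^sub>0\<close>
  (\<open>const_proj_injective\<close>, \<open>const_proj_surjective\<close>), and the images of the monomials in \<open>\<Gamma> \<union> {1}\<close> form
  a basis of \<open>A\<^sub>0\<close>: directly in \<open>K{X}\<close>, and in \<open>K{{X}}\<close> because \<open>\<Phi>\<close> also commutes with infinite sums.
\<close>

section \<open>Maps on series that are graded\<close>

lemma finite_deg_eq: "finite {s. deg s = n}"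
  by (rule finite_subset[OF _ finite_deg[of n]]) auto

lemma sum_ser_apply: "(\<Sum>i\<in>I. F i) u = (\<Sum>i\<in>I. (F i :: 'k::field ser) u)"
  by (induction I rule: infinite_finite_induct) auto

lemma scale_apply: "scale c f u = c * f u"
  by (simp add: scale_def)

text \<open>
  Evaluation of an eta-expanded zero series leaves the left-hand side, which other rewrite
  rules for \<open>0\<close> do not recognize.
\<close>

lemma zero_ser_eta [simp]: "(\<lambda>u. 0) = (0 :: 'k::field ser)"
  by (simp only: zero_fun_def)

definition vanishes_at :: "nat \<Rightarrow> 'k::field ser \<Rightarrow> bool" where
  "vanishes_at n f \<longleftrightarrow> (\<forall>u. deg u = n \<longrightarrow> f u = 0)"

lemma vanishes_atD: "vanishes_at n f \<Longrightarrow> deg u = n \<Longrightarrow> f u = 0"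
  by (simp add: vanishes_at_def)

lemma zero_if_vanishes_at: "(\<And>n. vanishes_at n f) \<Longrightarrow> f = 0"
  by (auto simp: vanishes_at_def fun_eq_iff)

text \<open>
  The homogeneous part of degree \<open>n\<close> of the value is determined by one homogeneous part of
  the argument. This is the form of continuity that all the maps below have; since each
  homogeneous part lies in a finite-dimensional space, such maps commute with infinite sums.
\<close>

definition graded_linear :: "('k::field ser \<Rightarrow> 'k ser) \<Rightarrow> bool" where
  "graded_linear T \<longleftrightarrow> module_hom scale scale T \<and>
     (\<forall>n. \<exists>m. \<forall>f. vanishes_at m f \<longrightarrow> vanishes_at n (T f))"

lemma graded_linear_hom: "graded_linear T \<Longrightarrow> module_hom scale scale T"
  by (simp add: graded_linear_def)

lemma module_hom_serI:
  assumes "\<And>f g. T (f + g) = T f + T g" "\<And>c f. T (scale c f) = scale c (T f)"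
  shows "module_hom scale scale (T :: 'k::field ser \<Rightarrow> 'k ser)"
  using assms ser.module_axioms by (simp add: module_hom_iff)

lemma graded_linear_comp:
  assumes "graded_linear S" "graded_linear T"
  shows "graded_linear (\<lambda>f. S (T f))"
proof -
  interpret S: module_hom scale scale S using assms(1) by (rule graded_linear_hom)
  interpret T: module_hom scale scale T using assms(2) by (rule graded_linear_hom)
  have "module_hom scale scale (\<lambda>f. S (T f))"
    by (rule module_hom_serI) (simp_all add: S.add T.add S.scale T.scale)
  moreover have "\<exists>m. \<forall>f. vanishes_at m f \<longrightarrow> vanishes_at n (S (T f))" for n
    using assms unfolding graded_linear_def by meson
  ultimately show ?thesis by (simp add: graded_linear_def)
qed

lemma graded_linear_funpow: "graded_linear T \<Longrightarrow> graded_linear (T ^^ n)"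
proof (induction n)
  case 0
  show ?case by (auto simp: graded_linear_def intro!: module_hom_serI)
next
  case (Suc n)
  then show ?case using graded_linear_comp[of T "T ^^ n"] by (simp add: comp_def)
qed

text \<open>
  The homogeneous part of \<open>f\<close> that matters is a finite combination of monomials, so the value
  is a finite combination with coefficients independent of \<open>f\<close>.
\<close>

lemma graded_linear_at:
  assumes "graded_linear T"
  obtains m where "\<And>f. T f u = (\<Sum>s | deg s = m. f s * T (mon_ser s) u)"
proof -
  interpret T: module_hom scale scale T using assms by (rule graded_linear_hom)
  obtain m where m: "\<And>f. vanishes_at m f \<Longrightarrow> vanishes_at (deg u) (T f)"
    using assms unfolding graded_linear_def by meson
  show ?thesis
  proof (rule that)
    fix f :: "'a ser"
    let ?g = "\<Sum>s | deg s = m. scale (f s) (mon_ser s)"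
    have "vanishes_at m (f - ?g)"
      by (auto simp: vanishes_at_def sum_ser_apply scale_apply mon_ser_def sum.delta
        finite_deg_eq if_distrib[of "\<lambda>x. f _ * x"] cong: if_cong)
    then have "T (f - ?g) u = 0"
      by (rule vanishes_atD[OF m refl])
    then have "T f u = T ?g u"
      by (simp add: T.diff)
    also have "\<dots> = (\<Sum>s | deg s = m. f s * T (mon_ser s) u)"
      by (simp add: T.sum T.scale sum_ser_apply scale_apply)
    finally show "T f u = (\<Sum>s | deg s = m. f s * T (mon_ser s) u)" .
  qed
qed

lemma ser_sum_expand:
  "finite I \<Longrightarrow> {i. F i u \<noteq> 0} \<subseteq> I \<Longrightarrow> ser_sum F u = (\<Sum>i\<in>I. F i u)"
  unfolding ser_sum_def by (rule Sum_any.expand_superset)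

lemma graded_linear_ser_sum:
  assumes T: "graded_linear T" and F: "\<And>u. finite {i. F i u \<noteq> 0}"
  shows "T (ser_sum F) = ser_sum (\<lambda>i. T (F i))"
proof
  fix u
  obtain m where m: "\<And>f. T f u = (\<Sum>s | deg s = m. f s * T (mon_ser s) u)"
    using graded_linear_at[OF T] by metis
  \<comment> \<open>the only members of the family that affect a coefficient in degree \<open>m\<close>\<close>
  define I where "I = (\<Union>s\<in>{s. deg s = m}. {i. F i s \<noteq> 0})"
  have I: "finite I" using F by (auto simp: I_def finite_deg_eq)
  have "T (ser_sum F) u = (\<Sum>s | deg s = m. (\<Sum>i\<in>I. F i s) * T (mon_ser s) u)"
    by (subst m, intro sum.cong refl arg_cong2[of _ _ _ _ "(*)"] ser_sum_expand I)
      (auto simp: I_def)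
  also have "\<dots> = (\<Sum>i\<in>I. \<Sum>s | deg s = m. F i s * T (mon_ser s) u)"
    unfolding sum_distrib_right by (rule sum.swap)
  also have "\<dots> = (\<Sum>i\<in>I. T (F i) u)"
    by (intro sum.cong refl m[symmetric])
  also have "\<dots> = ser_sum (\<lambda>i. T (F i)) u"
  proof (rule ser_sum_expand[symmetric, OF I], clarify)
    fix i assume "T (F i) u \<noteq> 0"
    then obtain s where "deg s = m" "F i s \<noteq> 0"
      unfolding m[of "F i"] by (auto elim!: sum.not_neutral_contains_not_neutral)
    then show "i \<in> I" by (auto simp: I_def)
  qed
  finally show "T (ser_sum F) u = ser_sum (\<lambda>i. T (F i)) u" .
qed

lemma ser_sum_monomials: "ser_sum (\<lambda>s. scale (f s) (mon_ser s)) = f"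
proof
  fix u
  have "ser_sum (\<lambda>s. scale (f s) (mon_ser s)) u = (\<Sum>s\<in>{u}. scale (f s) (mon_ser s) u)"
    by (rule ser_sum_expand) (auto simp: scale_apply mon_ser_def split: if_splits)
  then show "ser_sum (\<lambda>s. scale (f s) (mon_ser s)) u = f u"
    by (simp add: scale_apply mon_ser_def)
qed

lemma graded_linear_expand:
  assumes "graded_linear T"
  shows "T f = ser_sum (\<lambda>s. scale (f s) (T (mon_ser s)))"
proof -
  interpret T: module_hom scale scale T using assms by (rule graded_linear_hom)
  have "T (ser_sum (\<lambda>s. scale (f s) (mon_ser s))) = ser_sum (\<lambda>s. T (scale (f s) (mon_ser s)))"
  proof (rule graded_linear_ser_sum[OF assms])
    show "finite {s. scale (f s) (mon_ser s) u \<noteq> 0}" for u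
      by (rule finite_subset[of _ "{u}"]) (auto simp: scale_apply mon_ser_def split: if_splits)
  qed
  then show ?thesis by (simp add: ser_sum_monomials T.scale)
qed

section \<open>Left multiplication by a letter and the derivations\<close>

lemma letter_mult_eq_iff: "letter_mon a \<odot> v = letter_mon b \<odot> w \<longleftrightarrow> a = b \<and> v = w"
  by (cases v; cases w) auto

lemma Lmul_at_letter: "Lmul a f (letter_mon b \<odot> v) = (if a = b then f v else 0)"
proof -
  have "Lmul a f (letter_mon b \<odot> v) =
      (\<Sum>(p, q)\<in>(if a = b then {(letter_mon a, v)} else {}). mon_ser (letter_mon a) p * f q)"
    unfolding Lmul_def ser_mult_def
    by (rule sum.mono_neutral_right[OF finite_factorizations])
      (auto simp: mon_ser_def letter_mult_eq_iff split: if_splits)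
  then show ?thesis by (simp add: mon_ser_def)
qed

lemma Lmul_at_other: "(\<And>v. u \<noteq> letter_mon a \<odot> v) \<Longrightarrow> Lmul a f u = 0"
  unfolding Lmul_def ser_mult_def
  by (rule sum.neutral) (auto simp: mon_ser_def)

lemma Lmul_eqI:
  assumes "\<And>v. h (letter_mon a \<odot> v) = f v" "\<And>u. (\<And>v. u \<noteq> letter_mon a \<odot> v) \<Longrightarrow> h u = 0"
  shows "Lmul a f = h"
proof
  fix u
  show "Lmul a f u = h u"
    by (cases "\<exists>v. u = letter_mon a \<odot> v") (auto simp: assms Lmul_at_letter Lmul_at_other)
qed

lemma module_hom_Lmul: "module_hom scale scale (Lmul a)"
  by (rule module_hom_serI; rule Lmul_eqI)
    (simp_all add: Lmul_at_letter Lmul_at_other scale_apply)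

lemma module_hom_ser_deriv: "module_hom scale scale (ser_deriv a)"
  by (rule module_hom_serI) (simp_all add: ser_deriv_add ser_deriv_scale)

text \<open>
  The names \<open>Lmul.add\<close>, \<open>Lmul.scale\<close>, \<open>ser_deriv.diff\<close> etc. below are the linearity rules
  obtained here.
\<close>

interpretation Lmul: module_hom scale scale "Lmul a"
  by (rule module_hom_Lmul)

interpretation ser_deriv: module_hom scale scale "ser_deriv a"
  by (rule module_hom_ser_deriv)

lemma Lmul_eq_0_iff: "Lmul a f = 0 \<longleftrightarrow> f = 0"
proof
  assume "Lmul a f = 0"
  then show "f = 0" using Lmul_at_letter[of a f a] by (auto simp: fun_eq_iff)
qed simp

lemma vanishes_at_Lmul: "vanishes_at n f \<Longrightarrow> vanishes_at (Suc n) (Lmul a f)"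
  unfolding vanishes_at_def
proof (intro allI impI)
  fix u assume f: "\<forall>u. deg u = n \<longrightarrow> f u = 0" and u: "deg u = Suc n"
  show "Lmul a f u = 0"
  proof (cases "\<exists>v. u = letter_mon a \<odot> v")
    case True
    with f u show ?thesis by (auto simp: Lmul_at_letter)
  qed (simp add: Lmul_at_other)
qed

lemma vanishes_at_0_Lmul: "vanishes_at 0 (Lmul a f)"
  by (auto simp: vanishes_at_def intro!: Lmul_at_other)

lemma vanishes_at_ser_deriv: "vanishes_at (Suc n) f \<Longrightarrow> vanishes_at n (ser_deriv a f)"
  unfolding vanishes_at_def
proof (intro allI impI)
  fix u assume f: "\<forall>s. deg s = Suc n \<longrightarrow> f s = 0" and u: "deg u = n"
  have "f s * mon_deriv a s u = 0" for s
    using f u mon_deriv_deg[of a s u] by (cases "deg s = Suc n") auto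
  then show "ser_deriv a f u = 0"
    unfolding ser_deriv_eq_sum[OF finite_deg order_refl] by (intro sum.neutral ballI)
qed

lemma vanishes_at_Lmul_funpow:
  "vanishes_at n f \<Longrightarrow> vanishes_at (i + n) ((Lmul a ^^ i) f)"
  by (induction i) (auto intro: vanishes_at_Lmul)

lemma vanishes_at_below_Lmul_funpow: "n < i \<Longrightarrow> vanishes_at n ((Lmul a ^^ i) f)"
proof (induction i arbitrary: n)
  case (Suc i)
  then show ?case by (cases n) (auto intro: vanishes_at_Lmul vanishes_at_0_Lmul)
qed simp

lemma le_deg_if_Lmul_funpow: "(Lmul a ^^ i) f u \<noteq> 0 \<Longrightarrow> i \<le> deg u"
  using vanishes_atD[OF vanishes_at_below_Lmul_funpow refl] by (metis not_le)

lemma vanishes_at_ser_deriv_funpow: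
  "vanishes_at (i + n) f \<Longrightarrow> vanishes_at n ((ser_deriv a ^^ i) f)"
  by (induction i arbitrary: n) (auto intro: vanishes_at_ser_deriv)

lemma graded_linear_Lmul: "graded_linear (Lmul a :: 'k::field ser \<Rightarrow> 'k ser)"
proof -
  have "\<exists>m. \<forall>f::'k ser. vanishes_at m f \<longrightarrow> vanishes_at n (Lmul a f)" for n
    by (cases n) (auto intro: vanishes_at_Lmul vanishes_at_0_Lmul)
  then show ?thesis by (simp add: graded_linear_def module_hom_Lmul)
qed

lemma graded_linear_ser_deriv: "graded_linear (ser_deriv a)"
  using module_hom_ser_deriv vanishes_at_ser_deriv unfolding graded_linear_def by blast

lemma zero_ser_mult: "0 \<star> f = 0"
  by (rule ext) (auto simp: ser_mult_def intro!: sum.neutral)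

lemma ser_deriv_Lmul_same: "ser_deriv a (Lmul a f) = f + Lmul a (ser_deriv a f)"
  by (simp add: Lmul_def ser_deriv_mult ser_deriv_letter one_ser_mult)

lemma ser_deriv_Lmul_other: "a \<noteq> b \<Longrightarrow> ser_deriv a (Lmul b f) = Lmul b (ser_deriv a f)"
  by (simp add: Lmul_def ser_deriv_mult ser_deriv_letter zero_ser_mult)

lemma ser_deriv_mon_ser: "ser_deriv a (mon_ser s) = mon_deriv a s"
proof
  fix u
  let ?B = "insert s {s. deg s \<le> Suc (deg u)}"
  have "ser_deriv a (mon_ser s) u = (\<Sum>t\<in>?B. mon_ser s t * mon_deriv a t u)"
    by (rule ser_deriv_eq_sum) (auto simp: finite_deg)
  also have "\<dots> = (\<Sum>t\<in>?B. if t = s then mon_deriv a t u else 0)"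
    by (rule sum.cong) (auto simp: mon_ser_def)
  also have "\<dots> = mon_deriv a s u"
    by (subst sum.delta) (auto simp: finite_deg)
  finally show "ser_deriv a (mon_ser s) u = mon_deriv a s u" .
qed

lemma mon_ser_mult: "mon_ser p \<star> mon_ser q = mon_ser (p \<odot> q)"
proof
  fix u
  have "(mon_ser p \<star> mon_ser q) u =
      (\<Sum>(p', q')\<in>(if u = p \<odot> q then {(p, q)} else {}). mon_ser p p' * mon_ser q q')"
    unfolding ser_mult_def
    by (rule sum.mono_neutral_right[OF finite_factorizations])
      (auto simp: mon_ser_def split: if_splits)
  also have "\<dots> = mon_ser (p \<odot> q) u"
    by (simp add: mon_ser_def)
  finally show "(mon_ser p \<star> mon_ser q) u = mon_ser (p \<odot> q) u" .
qed

text \<open>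
  The commutator of two derivations is a derivation, and this one kills the letters, hence all
  trees; by continuity it is zero.
\<close>

lemma ser_deriv_commute: "ser_deriv a (ser_deriv b f) = ser_deriv b (ser_deriv a f)"
proof -
  have tree: "ser_deriv a (ser_deriv b (mon_ser (Some t))) =
      ser_deriv b (ser_deriv a (mon_ser (Some t)) :: 'a ser)" for t
  proof (induction t)
    case (Leaf c)
    have "ser_deriv d (mon_ser None :: 'a ser) = 0" for d
      by (simp add: ser_deriv_mon_ser mon_deriv_def)
    then have "ser_deriv d (ser_deriv e (mon_ser (letter_mon c))) = (0 :: 'a ser)" for d e
      by (cases "c = e") (simp_all only: ser_deriv_letter ser_deriv.zero simp_thms if_True if_False)
    then show ?case by simp
  next
    case (Node s t)
    have "mon_ser (Some (Node s t)) = mon_ser (Some s) \<star> (mon_ser (Some t) :: 'a ser)"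
      by (simp add: mon_ser_mult)
    with Node show ?case by (simp only: ser_deriv_mult ser_deriv_add ac_simps)
  qed
  have "ser_deriv a (ser_deriv b (mon_ser s)) =
      ser_deriv b (ser_deriv a (mon_ser s) :: 'a ser)" for s
    using tree by (cases s) (auto simp: ser_deriv_mon_ser mon_deriv_def)
  then show ?thesis
    using graded_linear_expand[OF graded_linear_comp[OF graded_linear_ser_deriv[of a]
        graded_linear_ser_deriv[of b]], of f]
      graded_linear_expand[OF graded_linear_comp[OF graded_linear_ser_deriv[of b]
        graded_linear_ser_deriv[of a]], of f]
    by simp
qed

section \<open>Division with remainder by a letter\<close>

text \<open>
  The operator \<open>L\<^sub>a D\<^sub>a\<close> behaves like the Euler operator \<open>x d/dx\<close>: it has no negative integer as an
  eigenvalue. The eigenvalue shifts from \<open>-(c+1)\<close> to \<open>-(c+2)\<close> on passing from \<open>h\<close> to \<open>D\<^sub>a h\<close>, while the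
  degree drops by one, so the induction is on the degree with \<open>c\<close> generalized.
\<close>

lemma vanishes_at_if_euler_eigen:
  fixes h :: "'k::field_char_0 ser"
  assumes "scale (of_nat (Suc c)) h + Lmul a (ser_deriv a h) = 0"
  shows "vanishes_at n h"
  using assms
proof (induction n arbitrary: c h)
  case (0 c h)
  have "h u = 0" if "deg u = 0" for u
    using fun_cong[OF 0, of u] vanishes_atD[OF vanishes_at_0_Lmul that, of a "ser_deriv a h"]
    by (simp add: scale_apply del: of_nat_Suc)
  then show ?case by (simp add: vanishes_at_def)
next
  case (Suc n c h)
  have "scale (of_nat (Suc (Suc c))) (ser_deriv a h) + Lmul a (ser_deriv a (ser_deriv a h)) =
      scale (of_nat (Suc c)) (ser_deriv a h) +
      (ser_deriv a h + Lmul a (ser_deriv a (ser_deriv a h)))"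
    by (simp add: scale_def fun_eq_iff algebra_simps)
  also have "\<dots> = ser_deriv a (scale (of_nat (Suc c)) h + Lmul a (ser_deriv a h))"
    by (simp only: ser_deriv.add ser_deriv.scale ser_deriv_Lmul_same)
  also have "\<dots> = 0" by (simp only: Suc.prems ser_deriv.zero)
  finally have "vanishes_at n (ser_deriv a h)" by (rule Suc.IH)
  then have *: "vanishes_at (Suc n) (Lmul a (ser_deriv a h))" by (rule vanishes_at_Lmul)
  have "h u = 0" if "deg u = Suc n" for u
    using fun_cong[OF Suc.prems, of u] vanishes_atD[OF * that]
    by (simp add: scale_apply del: of_nat_Suc)
  then show ?case by (simp add: vanishes_at_def)
qed

text \<open>
  Uniqueness of division by a letter: this is the case of eigenvalue \<open>-1\<close>, since
  \<open>D\<^sub>a L\<^sub>a = 1 + L\<^sub>a D\<^sub>a\<close>.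
\<close>

lemma ser_deriv_Lmul_eq_0:
  fixes h :: "'k::field_char_0 ser"
  assumes "ser_deriv a (Lmul a h) = 0"
  shows "h = 0"
proof (rule zero_if_vanishes_at)
  show "vanishes_at n h" for n
    using assms by (intro vanishes_at_if_euler_eigen[of 0 h a])
      (simp add: ser_deriv_Lmul_same)
qed

text \<open>
  The infinite sum \<open>\<Sum>\<^sub>i (-1)\<^sup>i/(i+1)! L\<^sub>a\<^sup>i D\<^sub>a\<^sup>i\<^sup>+\<^sup>1 f\<close>, cut off at \<open>i = deg u\<close> in the coefficient of \<open>u\<close>
  since \<open>L\<^sub>a\<^sup>i\<close> raises the degree by \<open>i\<close>. The remainder below is then the classical
  \<open>\<Sum>\<^sub>i (-1)\<^sup>i/i! L\<^sub>a\<^sup>i D\<^sub>a\<^sup>i f\<close>.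
\<close>

definition taylor_quot :: "letter \<Rightarrow> 'k::field_char_0 ser \<Rightarrow> 'k ser" where
  "taylor_quot a f = (\<lambda>u. \<Sum>i\<le>deg u.
     (- 1) ^ i / fact (Suc i) * (Lmul a ^^ i) ((ser_deriv a ^^ Suc i) f) u)"

definition taylor_const :: "letter \<Rightarrow> 'k::field_char_0 ser \<Rightarrow> 'k ser" where
  "taylor_const a f = f - Lmul a (taylor_quot a f)"

lemma vanishes_at_taylor_quot:
  assumes "vanishes_at (Suc n) f"
  shows "vanishes_at n (taylor_quot a f)"
proof -
  have "vanishes_at n ((Lmul a ^^ i) ((ser_deriv a ^^ Suc i) f))" if "i \<le> n" for i
    using vanishes_at_Lmul_funpow[OF vanishes_at_ser_deriv_funpow, of "Suc i" "n - i" f i a a]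
      assms that by simp
  then show ?thesis
    by (auto simp: vanishes_at_def taylor_quot_def intro!: sum.neutral)
qed

lemma module_hom_taylor_quot: "module_hom scale scale (taylor_quot a)"
proof -
  interpret L: module_hom scale scale "Lmul a ^^ i" for i
    by (rule graded_linear_hom[OF graded_linear_funpow[OF graded_linear_Lmul]])
  interpret D: module_hom scale scale "ser_deriv a ^^ i" for i
    by (rule graded_linear_hom[OF graded_linear_funpow[OF graded_linear_ser_deriv]])
  show ?thesis
    by (rule module_hom_serI; rule ext)
      (simp_all add: taylor_quot_def L.add D.add L.scale D.scale scale_apply sum.distrib
        sum_distrib_left distrib_left mult.left_commute del: funpow.simps fact_Suc)
qed

interpretation taylor_quot: module_hom scale scale "taylor_quot a"
  by (rule module_hom_taylor_quot)

lemma ser_deriv_Lmul_Suc_funpow: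
  "ser_deriv a ((Lmul a ^^ Suc n) g) =
     scale (of_nat (Suc n)) ((Lmul a ^^ n) g) + (Lmul a ^^ Suc n) (ser_deriv a g)"
proof (induction n)
  case 0
  show ?case by (simp add: ser_deriv_Lmul_same)
next
  case (Suc n)
  have "ser_deriv a ((Lmul a ^^ Suc (Suc n)) g) =
      (Lmul a ^^ Suc n) g + Lmul a (ser_deriv a ((Lmul a ^^ Suc n) g))"
    by (simp only: funpow.simps comp_def ser_deriv_Lmul_same)
  also have "\<dots> = (Lmul a ^^ Suc n) g +
      (scale (of_nat (Suc n)) (Lmul a ((Lmul a ^^ n) g)) + Lmul a ((Lmul a ^^ Suc n) (ser_deriv a g)))"
    by (simp only: Suc Lmul.add Lmul.scale)
  also have "\<dots> = scale (of_nat (Suc (Suc n))) ((Lmul a ^^ Suc n) g) +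
      (Lmul a ^^ Suc (Suc n)) (ser_deriv a g)"
    by (simp add: scale_def fun_eq_iff algebra_simps)
  finally show ?case .
qed

text \<open>
  Existence of division by a letter: applied to the partial sums of \<open>taylor_quot\<close>, the operator
  \<open>D\<^sub>a L\<^sub>a\<close> telescopes to \<open>D\<^sub>a f\<close>, up to an error that lives in ever higher degrees.
\<close>

lemma ser_deriv_Lmul_taylor_quot:
  fixes f :: "'k::field_char_0 ser"
  shows "ser_deriv a (Lmul a (taylor_quot a f)) = ser_deriv a f"
proof
  fix u
  let ?c = "\<lambda>i. (- 1) ^ i / fact (Suc i) :: 'k"
  let ?T = "\<lambda>i. (Lmul a ^^ i) ((ser_deriv a ^^ Suc i) f)"
  define P where "P n = (\<Sum>i\<le>n. scale (?c i) (?T i))" for n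
  have telescope: "ser_deriv a (Lmul a (P n)) =
      ser_deriv a f + scale (?c n) ((Lmul a ^^ Suc n) ((ser_deriv a ^^ Suc (Suc n)) f))" for n
  proof (induction n)
    case 0
    show ?case by (simp add: P_def ser_deriv_Lmul_same)
  next
    case (Suc n)
    let ?g = "(ser_deriv a ^^ Suc (Suc n)) f"
    have 1: "?c (Suc n) * of_nat (Suc (Suc n)) = - ?c n"
      by (simp add: divide_simps del: of_nat_Suc)
    have "ser_deriv a (Lmul a (P (Suc n))) =
        ser_deriv a (Lmul a (P n)) +
        scale (?c (Suc n)) (ser_deriv a ((Lmul a ^^ Suc (Suc n)) ?g))"
      by (simp only: P_def sum.atMost_Suc Lmul.add ser_deriv.add Lmul.scale ser_deriv.scale
        funpow.simps(2)[of "Suc n" "Lmul a"] comp_apply)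
    also have "\<dots> = ser_deriv a f + scale (?c n) ((Lmul a ^^ Suc n) ?g) +
        (scale (- ?c n) ((Lmul a ^^ Suc n) ?g) +
         scale (?c (Suc n)) ((Lmul a ^^ Suc (Suc n)) (ser_deriv a ?g)))"
      unfolding Suc ser_deriv_Lmul_Suc_funpow[of a "Suc n"] ser.scale_right_distrib
        ser.scale_scale 1 ..
    finally show ?case
      by (simp add: scale_def fun_eq_iff del: fact_Suc)
  qed
  have "vanishes_at (deg u) (taylor_quot a f - P (deg u))"
    by (auto simp: vanishes_at_def taylor_quot_def P_def sum_ser_apply scale_apply)
  then have "ser_deriv a (Lmul a (taylor_quot a f - P (deg u))) u = 0"
    by (intro vanishes_atD[OF vanishes_at_ser_deriv refl] vanishes_at_Lmul)
  moreover have "(Lmul a ^^ Suc (deg u)) ((ser_deriv a ^^ Suc (Suc (deg u))) f) u = 0"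
    by (rule vanishes_atD[OF vanishes_at_below_Lmul_funpow refl]) simp
  ultimately show "ser_deriv a (Lmul a (taylor_quot a f)) u = ser_deriv a f u"
    by (simp add: Lmul.diff ser_deriv.diff telescope scale_apply del: funpow.simps)
qed

lemma ser_deriv_taylor_const: "ser_deriv a (taylor_const a f) = 0"
  by (simp add: taylor_const_def ser_deriv.diff ser_deriv_Lmul_taylor_quot)

lemma taylor_decomp: "f = taylor_const a f + Lmul a (taylor_quot a f)"
  by (simp add: taylor_const_def)

lemma taylor_decomp_unique:
  assumes "ser_deriv a b = 0"
  shows "taylor_quot a (b + Lmul a g) = g" "taylor_const a (b + Lmul a g) = b"
proof -
  let ?f = "b + Lmul a g"
  have "ser_deriv a (Lmul a (taylor_quot a ?f - g)) = 0"
    by (simp add: Lmul.diff ser_deriv.diff ser_deriv_Lmul_taylor_quot ser_deriv.add assms)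
  then have "taylor_quot a ?f - g = 0" by (rule ser_deriv_Lmul_eq_0)
  then show "taylor_quot a ?f = g" by simp
  then show "taylor_const a ?f = b" by (simp add: taylor_const_def)
qed


lemma vanishes_at_taylor_const:
  assumes "vanishes_at n f"
  shows "vanishes_at n (taylor_const a f)"
proof -
  have "vanishes_at n (Lmul a (taylor_quot a f))"
    using assms by (cases n) (auto intro: vanishes_at_0_Lmul vanishes_at_Lmul vanishes_at_taylor_quot)
  with assms show ?thesis by (simp add: vanishes_at_def taylor_const_def)
qed

lemma graded_linear_taylor_const: "graded_linear (taylor_const a)"
proof -
  have "module_hom scale scale (taylor_const a)"
    by (rule module_hom_serI)
      (simp_all add: taylor_const_def taylor_quot.add taylor_quot.scale Lmul.add Lmul.scale
        ser.scale_right_diff_distrib)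
  then show ?thesis
    using vanishes_at_taylor_const unfolding graded_linear_def by blast
qed

interpretation taylor_const: module_hom scale scale "taylor_const a"
  by (rule graded_linear_hom[OF graded_linear_taylor_const])

lemma taylor_const_eq_self: "ser_deriv a f = 0 \<Longrightarrow> taylor_const a f = f"
  using taylor_decomp_unique(2)[of a f 0] by simp

lemma taylor_const_Lmul: "taylor_const a (Lmul a f) = 0"
  using taylor_decomp_unique(2)[of a 0 f] by simp

text \<open>
  For \<open>a \<noteq> b\<close>, division by \<open>b\<close> commutes with \<open>D\<^sub>a\<close>: applying \<open>D\<^sub>a\<close> to the decomposition of \<open>f\<close> with
  respect to \<open>b\<close> gives the decomposition of \<open>D\<^sub>a f = 0\<close>, whose parts are zero by uniqueness.
  For \<open>a = b\<close> the quotient itself is zero.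
\<close>

lemma ser_deriv_taylor_other:
  assumes "ser_deriv a f = 0"
  shows "ser_deriv a (taylor_const b f) = 0" "ser_deriv a (taylor_quot b f) = 0"
proof -
  show c: "ser_deriv a (taylor_const b f) = 0"
  proof (cases "a = b")
    case False
    have "ser_deriv b (ser_deriv a (taylor_const b f)) = 0"
      by (simp add: ser_deriv_commute[of b a] ser_deriv_taylor_const)
    moreover have "ser_deriv a (taylor_const b f) + Lmul b (ser_deriv a (taylor_quot b f)) = 0"
      using assms by (subst (asm) taylor_decomp[of f b])
        (simp add: ser_deriv.add ser_deriv_Lmul_other[OF False])
    ultimately show ?thesis
      using taylor_decomp_unique(2)[of b "ser_deriv a (taylor_const b f)"
          "ser_deriv a (taylor_quot b f)"] by simp
  qed (simp add: ser_deriv_taylor_const)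
  show "ser_deriv a (taylor_quot b f) = 0"
  proof (cases "a = b")
    case True
    with assms have "taylor_quot b f = 0"
      using taylor_decomp_unique(1)[of a f 0] by simp
    then show ?thesis by simp
  next
    case False
    have "Lmul b (ser_deriv a (taylor_quot b f)) = 0"
      using assms c by (subst (asm) (1) taylor_decomp[of f b])
        (simp add: ser_deriv.add ser_deriv_Lmul_other[OF False])
    then show ?thesis by (simp add: Lmul_eq_0_iff)
  qed
qed

section \<open>Taylor expansions\<close>

definition taylor_coeff :: "letter \<Rightarrow> 'k::field_char_0 ser \<Rightarrow> nat \<Rightarrow> 'k ser" where
  "taylor_coeff a f j = taylor_const a ((taylor_quot a ^^ j) f)"

lemma taylor_coeff_0: "taylor_coeff a f 0 = taylor_const a f"
  by (simp add: taylor_coeff_def)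

lemma taylor_coeff_Suc: "taylor_coeff a f (Suc j) = taylor_coeff a (taylor_quot a f) j"
  by (simp add: taylor_coeff_def funpow_Suc_right del: funpow.simps)

lemma finite_Lmul_funpow: "finite {j. (Lmul a ^^ j) (b j) u \<noteq> 0}"
proof (rule finite_subset)
  show "{j. (Lmul a ^^ j) (b j) u \<noteq> 0} \<subseteq> {..deg u}"
    by (auto dest: le_deg_if_Lmul_funpow)
qed simp

lemma ser_sum_Lmul_funpow:
  "deg u \<le> n \<Longrightarrow> ser_sum (\<lambda>j. (Lmul a ^^ j) (b j)) u = (\<Sum>j\<le>n. (Lmul a ^^ j) (b j) u)"
  by (intro ser_sum_expand) (auto dest: le_deg_if_Lmul_funpow)

text \<open>
  The Horner form of an expansion: its first coefficient is the remainder, and the shifted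
  expansion is the quotient, of division by \<open>a\<close>.
\<close>

lemma ser_sum_Lmul_funpow_Suc:
  "ser_sum (\<lambda>j. (Lmul a ^^ j) (b j)) = b 0 + Lmul a (ser_sum (\<lambda>j. (Lmul a ^^ j) (b (Suc j))))"
proof
  fix u
  have "ser_sum (\<lambda>j. (Lmul a ^^ j) (b j)) u = (\<Sum>j\<le>Suc (deg u). (Lmul a ^^ j) (b j) u)"
    by (rule ser_sum_Lmul_funpow) simp
  also have "\<dots> = b 0 u + (\<Sum>j\<le>deg u. Lmul a ((Lmul a ^^ j) (b (Suc j))) u)"
    by (simp only: sum.atMost_Suc_shift funpow.simps id_apply comp_apply)
  also have "(\<Sum>j\<le>deg u. Lmul a ((Lmul a ^^ j) (b (Suc j))) u) =
      ser_sum (\<lambda>j. Lmul a ((Lmul a ^^ j) (b (Suc j)))) u"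
    using le_deg_if_Lmul_funpow[of "Suc _" a _ u]
    by (intro ser_sum_expand[symmetric]) (auto simp: Suc_le_eq dest: less_imp_le)
  also have "\<dots> = Lmul a (ser_sum (\<lambda>j. (Lmul a ^^ j) (b (Suc j)))) u"
    by (simp add: graded_linear_ser_sum[OF graded_linear_Lmul finite_Lmul_funpow])
  finally show "ser_sum (\<lambda>j. (Lmul a ^^ j) (b j)) u =
      (b 0 + Lmul a (ser_sum (\<lambda>j. (Lmul a ^^ j) (b (Suc j))))) u" by simp
qed

lemma taylor_coeff_unique:
  assumes "\<And>j. ser_deriv a (b j) = 0"
  shows "taylor_coeff a (ser_sum (\<lambda>j. (Lmul a ^^ j) (b j))) j = b j"
  using assms
proof (induction j arbitrary: b)
  case (0 b)
  then show ?case
    by (subst ser_sum_Lmul_funpow_Suc) (simp add: taylor_coeff_0 taylor_decomp_unique)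
next
  case (Suc j b)
  have "taylor_quot a (ser_sum (\<lambda>j. (Lmul a ^^ j) (b j))) = ser_sum (\<lambda>j. (Lmul a ^^ j) (b (Suc j)))"
    by (subst ser_sum_Lmul_funpow_Suc) (simp add: taylor_decomp_unique Suc.prems)
  with Suc show ?case by (simp add: taylor_coeff_Suc)
qed

lemma taylor_expansion: "ser_sum (\<lambda>j. (Lmul a ^^ j) (taylor_coeff a f j)) = f"
proof
  fix u
  interpret L: module_hom scale scale "Lmul a ^^ i" for i
    by (rule graded_linear_hom[OF graded_linear_funpow[OF graded_linear_Lmul]])
  have *: "f = (\<Sum>j<n. (Lmul a ^^ j) (taylor_coeff a f j)) + (Lmul a ^^ n) ((taylor_quot a ^^ n) f)"
    for n
  proof (induction n)
    case (Suc n)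
    let ?g = "(taylor_quot a ^^ n) f"
    have "(Lmul a ^^ n) ?g = (Lmul a ^^ n) (taylor_const a ?g + Lmul a (taylor_quot a ?g))"
      by (simp only: taylor_decomp[symmetric])
    also have "\<dots> = (Lmul a ^^ n) (taylor_coeff a f n) + (Lmul a ^^ Suc n) ((taylor_quot a ^^ Suc n) f)"
      by (simp add: L.add taylor_coeff_def funpow_swap1)
    finally have eq: "(Lmul a ^^ n) ?g =
      (Lmul a ^^ n) (taylor_coeff a f n) + (Lmul a ^^ Suc n) ((taylor_quot a ^^ Suc n) f)" .
    show ?case
      unfolding sum.lessThan_Suc add.assoc eq[symmetric] by (rule Suc)
  qed simp
  have "(Lmul a ^^ Suc (deg u)) ((taylor_quot a ^^ Suc (deg u)) f) u = 0"
    by (rule vanishes_atD[OF vanishes_at_below_Lmul_funpow refl]) simp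
  then have "f u = (\<Sum>j<Suc (deg u). (Lmul a ^^ j) (taylor_coeff a f j) u)"
    using fun_cong[OF *[of "Suc (deg u)"], of u]
    by (simp add: sum_ser_apply del: sum.lessThan_Suc funpow.simps)
  then show "ser_sum (\<lambda>j. (Lmul a ^^ j) (taylor_coeff a f j)) u = f u"
    by (simp add: ser_sum_Lmul_funpow[OF order_refl] lessThan_Suc_atMost)
qed

lemma ser_deriv_taylor_coeff: "ser_deriv a (taylor_coeff a f j) = 0"
  by (simp add: taylor_coeff_def ser_deriv_taylor_const)

lemma ser_deriv_taylor_coeff_other:
  assumes "ser_deriv a f = 0"
  shows "ser_deriv a (taylor_coeff b f j) = 0"
proof -
  have "ser_deriv a ((taylor_quot b ^^ j) f) = 0"
    by (induction j) (simp_all add: assms ser_deriv_taylor_other)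
  then show ?thesis by (simp add: taylor_coeff_def ser_deriv_taylor_other)
qed

lemma ser_deriv_ser_sum_Lmul_other:
  assumes "a \<noteq> b" "\<And>j. ser_deriv a (c j) = 0"
  shows "ser_deriv a (ser_sum (\<lambda>j. (Lmul b ^^ j) (c j))) = 0"
proof -
  have "ser_deriv a ((Lmul b ^^ i) (c j)) = 0" for i j
    by (induction i) (simp_all add: assms ser_deriv_Lmul_other[OF assms(1)])
  then show ?thesis
    by (simp add: graded_linear_ser_sum[OF graded_linear_ser_deriv finite_Lmul_funpow])
      (simp add: ser_sum_def fun_eq_iff)
qed

lemma le_deg_if_Lmul_funpow_pair:
  assumes "(Lmul a ^^ i) ((Lmul b ^^ j) f) u \<noteq> 0"
  shows "i \<le> deg u \<and> j \<le> deg u"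
proof
  show i: "i \<le> deg u" by (rule le_deg_if_Lmul_funpow[OF assms])
  show "j \<le> deg u"
  proof (rule ccontr)
    assume "\<not> j \<le> deg u"
    then have "vanishes_at (i + (deg u - i)) ((Lmul a ^^ i) ((Lmul b ^^ j) f))"
      by (intro vanishes_at_Lmul_funpow vanishes_at_below_Lmul_funpow) auto
    with assms i show False by (auto dest: vanishes_atD)
  qed
qed

text \<open>
  A total expansion is a partial expansion in \<open>a\<close> whose coefficients are partial expansions
  in \<open>b\<close>.
\<close>

lemma ser_sum_pairs:
  "ser_sum (\<lambda>(i, j). (Lmul a ^^ i) ((Lmul b ^^ j) (c (i, j)))) =
   ser_sum (\<lambda>i. (Lmul a ^^ i) (ser_sum (\<lambda>j. (Lmul b ^^ j) (c (i, j)))))"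
proof
  fix u
  let ?T = "\<lambda>i j. (Lmul a ^^ i) ((Lmul b ^^ j) (c (i, j))) u"
  have "ser_sum (\<lambda>(i, j). (Lmul a ^^ i) ((Lmul b ^^ j) (c (i, j)))) u =
      (\<Sum>p\<in>{..deg u} \<times> {..deg u}. (case p of (i, j) \<Rightarrow> (Lmul a ^^ i) ((Lmul b ^^ j) (c (i, j)))) u)"
    by (rule ser_sum_expand) (auto dest: le_deg_if_Lmul_funpow_pair)
  also have "\<dots> = (\<Sum>i\<le>deg u. \<Sum>j\<le>deg u. ?T i j)"
    by (simp add: sum.cartesian_product case_prod_beta)
  also have "\<dots> = (\<Sum>i\<le>deg u. ser_sum (\<lambda>j. (Lmul a ^^ i) ((Lmul b ^^ j) (c (i, j)))) u)"
    by (intro sum.cong refl ser_sum_expand[symmetric]) (auto dest: le_deg_if_Lmul_funpow_pair)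
  also have "\<dots> = (\<Sum>i\<le>deg u. (Lmul a ^^ i) (ser_sum (\<lambda>j. (Lmul b ^^ j) (c (i, j)))) u)"
    by (simp only: graded_linear_ser_sum[OF graded_linear_funpow[OF graded_linear_Lmul]
      finite_Lmul_funpow])
  also have "\<dots> = ser_sum (\<lambda>i. (Lmul a ^^ i) (ser_sum (\<lambda>j. (Lmul b ^^ j) (c (i, j))))) u"
    by (rule ser_sum_Lmul_funpow[OF order_refl, symmetric])
  finally show "ser_sum (\<lambda>(i, j). (Lmul a ^^ i) ((Lmul b ^^ j) (c (i, j)))) u =
    ser_sum (\<lambda>i. (Lmul a ^^ i) (ser_sum (\<lambda>j. (Lmul b ^^ j) (c (i, j))))) u" .
qed

definition total_coeff :: "'k::field_char_0 ser \<Rightarrow> nat \<times> nat \<Rightarrow> 'k ser" where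
  "total_coeff f = (\<lambda>(i, j). taylor_coeff LY (taylor_coeff LX f i) j)"

lemma total_coeff_expansion:
  "ser_sum (\<lambda>(i, j). (Lmul LX ^^ i) ((Lmul LY ^^ j) (total_coeff f (i, j)))) = f"
  unfolding ser_sum_pairs by (simp add: total_coeff_def taylor_expansion)

text \<open>
  The inner sums \<open>\<Sum>\<^sub>j L\<^sub>y\<^sup>j c\<^sub>i\<^sub>j\<close> are annihilated by \<open>D\<^sub>x\<close> because it commutes with \<open>L\<^sub>y\<close>, so they
  are the coefficients of the partial expansion in \<open>x\<close>; each of them is in turn a partial
  expansion in \<open>y\<close>.
\<close>

lemma total_coeff_unique:
  assumes "\<And>p. ser_deriv LX (c p) = 0" "\<And>p. ser_deriv LY (c p) = 0"
  shows "total_coeff (ser_sum (\<lambda>(i, j). (Lmul LX ^^ i) ((Lmul LY ^^ j) (c (i, j))))) = c"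
proof (rule ext, clarify)
  fix i j
  let ?b = "\<lambda>i. ser_sum (\<lambda>j. (Lmul LY ^^ j) (c (i, j)))"
  have "taylor_coeff LX (ser_sum (\<lambda>i. (Lmul LX ^^ i) (?b i))) i = ?b i"
    by (rule taylor_coeff_unique) (simp add: ser_deriv_ser_sum_Lmul_other assms)
  moreover have "taylor_coeff LY (?b i) j = c (i, j)"
    by (rule taylor_coeff_unique) (rule assms)
  ultimately show "total_coeff (ser_sum (\<lambda>(i, j). (Lmul LX ^^ i) ((Lmul LY ^^ j) (c (i, j)))))
    (i, j) = c (i, j)"
    unfolding ser_sum_pairs by (simp add: total_coeff_def)
qed

section \<open>The projectors on the two algebras\<close>

lemma alg_Free_iff: "f \<in> alg Free \<longleftrightarrow> (\<exists>n. \<forall>m\<ge>n. vanishes_at m f)"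
proof
  assume "f \<in> alg Free"
  then have "finite (deg ` {u. f u \<noteq> 0})" by simp
  then obtain n where "\<forall>i \<in> deg ` {u. f u \<noteq> 0}. i < n"
    by (auto simp: finite_nat_set_iff_bounded)
  then have "deg u < n" if "f u \<noteq> 0" for u using that by blast
  then have "\<forall>m\<ge>n. vanishes_at m f" unfolding vanishes_at_def by (meson not_le)
  then show "\<exists>n. \<forall>m\<ge>n. vanishes_at m f" ..
next
  assume "\<exists>n. \<forall>m\<ge>n. vanishes_at m f"
  then obtain n where "\<forall>m\<ge>n. vanishes_at m f" ..
  then have "{u. f u \<noteq> 0} \<subseteq> {u. deg u \<le> n}"
    unfolding vanishes_at_def by (metis (mono_tags) mem_Collect_eq nat_le_linear subsetI)
  then show "f \<in> alg Free" by (simp add: finite_subset[OF _ finite_deg])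
qed

text \<open>
  The form in which \<open>K{X}\<close> is seen to be closed under the remainder and the quotient maps: each
  homogeneous part of \<open>g\<close> depends on parts of \<open>f\<close> of the same or the next higher degree only.
\<close>

lemma alg_if_vanishes_at:
  assumes "f \<in> alg k" "\<And>m. vanishes_at m f \<Longrightarrow> vanishes_at (Suc m) f \<Longrightarrow> vanishes_at m g"
  shows "g \<in> alg k"
proof (cases k)
  case Free
  with assms(1) obtain n where "\<And>m. n \<le> m \<Longrightarrow> vanishes_at m f"
    by (auto simp: alg_Free_iff simp del: alg.simps)
  then have "\<forall>m\<ge>n. vanishes_at m g" using assms(2) by simp
  then show ?thesis unfolding Free alg_Free_iff ..
qed simp

lemma taylor_const_in_alg: "f \<in> alg k \<Longrightarrow> taylor_const a f \<in> alg k"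
  by (erule alg_if_vanishes_at) (rule vanishes_at_taylor_const)

lemma taylor_quot_in_alg: "f \<in> alg k \<Longrightarrow> taylor_quot a f \<in> alg k"
  by (erule alg_if_vanishes_at) (rule vanishes_at_taylor_quot)

lemma taylor_coeff_in_alg:
  assumes "f \<in> alg k"
  shows "taylor_coeff a f j \<in> alg k"
proof -
  have "(taylor_quot a ^^ j) f \<in> alg k"
    by (induction j) (simp_all add: assms taylor_quot_in_alg del: alg.simps)
  then show ?thesis by (simp add: taylor_coeff_def taylor_const_in_alg)
qed

lemma vanishes_at_taylor_quot_funpow:
  "vanishes_at (i + n) f \<Longrightarrow> vanishes_at n ((taylor_quot a ^^ i) f)"
  by (induction i arbitrary: n) (auto intro: vanishes_at_taylor_quot)

lemma vanishes_at_taylor_coeff: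
  "vanishes_at (j + n) f \<Longrightarrow> vanishes_at n (taylor_coeff a f j)"
  unfolding taylor_coeff_def
  by (intro vanishes_at_taylor_const vanishes_at_taylor_quot_funpow)

lemma taylor_coeff_eq_0:
  assumes "\<And>m. n \<le> m \<Longrightarrow> vanishes_at m f" "n \<le> j"
  shows "taylor_coeff a f j = 0"
  by (intro zero_if_vanishes_at vanishes_at_taylor_coeff assms(1) trans_le_add1 assms(2))

lemma partial_expansion_iff:
  assumes "f \<in> alg k"
  shows "partial_expansion k a f b \<longleftrightarrow> b = taylor_coeff a f"
proof
  assume "partial_expansion k a f b"
  then have "f = ser_sum (\<lambda>j. (Lmul a ^^ j) (b j))" "\<And>j. ser_deriv a (b j) = 0"
    by (auto simp: partial_expansion_def)
  then show "b = taylor_coeff a f"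
    using taylor_coeff_unique[of a b] by auto
next
  assume b: "b = taylor_coeff a f"
  have "summable_in k (\<lambda>j. (Lmul a ^^ j) (taylor_coeff a f j))"
  proof (cases k)
    case Free
    with assms obtain n where n: "\<And>m. n \<le> m \<Longrightarrow> vanishes_at m f"
      by (auto simp: alg_Free_iff simp del: alg.simps)
    interpret L: module_hom scale scale "Lmul a ^^ i" for i
      by (rule graded_linear_hom[OF graded_linear_funpow[OF graded_linear_Lmul]])
    have "{j. (Lmul a ^^ j) (taylor_coeff a f j) \<noteq> 0} \<subseteq> {..n}"
    proof
      fix j assume "j \<in> {j. (Lmul a ^^ j) (taylor_coeff a f j) \<noteq> 0}"
      then have "taylor_coeff a f j \<noteq> 0" by (auto simp: L.zero)
      then show "j \<in> {..n}" using taylor_coeff_eq_0[of n f j a] n by (cases "n \<le> j") auto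
    qed
    then show ?thesis using Free by (simp add: finite_subset)
  next
    case Completed
    then show ?thesis by (simp add: finite_Lmul_funpow)
  qed
  then show "partial_expansion k a f b"
    by (simp add: partial_expansion_def b taylor_coeff_in_alg[OF assms] ser_deriv_taylor_coeff
      taylor_expansion)
qed

lemma partial_Phi_eq: "f \<in> alg k \<Longrightarrow> partial_Phi k a f = taylor_const a f"
  by (simp add: partial_Phi_def partial_expansion_iff taylor_coeff_0)

lemma total_coeff_in_A0: "f \<in> alg k \<Longrightarrow> total_coeff f p \<in> A0 k"
  by (cases p) (simp add: A0_def total_coeff_def taylor_coeff_in_alg ser_deriv_taylor_coeff
    ser_deriv_taylor_coeff_other)

lemma total_expansion_iff:
  assumes "f \<in> alg k"
  shows "total_expansion k f c \<longleftrightarrow> c = total_coeff f"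
proof
  assume "total_expansion k f c"
  then have "f = ser_sum (\<lambda>(i, j). (Lmul LX ^^ i) ((Lmul LY ^^ j) (c (i, j))))"
    "\<And>p. ser_deriv LX (c p) = 0" "\<And>p. ser_deriv LY (c p) = 0"
    by (auto simp: total_expansion_def A0_def)
  then show "c = total_coeff f"
    using total_coeff_unique[of c] by simp
next
  assume c: "c = total_coeff f"
  let ?F = "\<lambda>(i, j). (Lmul LX ^^ i) ((Lmul LY ^^ j) (total_coeff f (i, j)))"
  interpret L: module_hom scale scale "Lmul a ^^ i" for i a
    by (rule graded_linear_hom[OF graded_linear_funpow[OF graded_linear_Lmul]])
  have "summable_in k ?F"
  proof (cases k)
    case Free
    with assms obtain n where n: "\<And>m. n \<le> m \<Longrightarrow> vanishes_at m f"
      by (auto simp: alg_Free_iff simp del: alg.simps)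
    have "total_coeff f (i, j) = 0" if "n \<le> i \<or> n \<le> j" for i j
    proof (cases "n \<le> i")
      case True
      then have "taylor_coeff LX f i = 0" by (intro taylor_coeff_eq_0[OF n])
      then show ?thesis by (simp add: total_coeff_def taylor_coeff_eq_0[of 0] vanishes_at_def)
    next
      case False
      with that have "n \<le> j" by simp
      then have "taylor_coeff LY (taylor_coeff LX f i) j = 0"
        by (intro taylor_coeff_eq_0[of n] vanishes_at_taylor_coeff n) simp_all
      then show ?thesis by (simp add: total_coeff_def)
    qed
    then have "p \<in> {..n} \<times> {..n}" if "total_coeff f p \<noteq> 0" for p
      using that by (cases p) (auto simp: not_le[symmetric])
    moreover have "total_coeff f p \<noteq> 0" if "?F p \<noteq> 0" for p
      using that by (cases p) (auto simp: L.zero)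
    ultimately have "{p. ?F p \<noteq> 0} \<subseteq> {..n} \<times> {..n}" by blast
    then show ?thesis using Free by (simp add: finite_subset)
  next
    case Completed
    have "{p. ?F p u \<noteq> 0} \<subseteq> {..deg u} \<times> {..deg u}" for u
      by (auto dest: le_deg_if_Lmul_funpow_pair)
    then have "finite {p. ?F p u \<noteq> 0}" for u by (rule finite_subset) simp
    then show ?thesis using Completed by simp
  qed
  then show "total_expansion k f c"
    by (simp add: total_expansion_def c total_coeff_in_A0[OF assms] total_coeff_expansion)
qed

text \<open>
  The operator \<open>\<Phi>\<^sub>2 \<circ> \<Phi>\<^sub>1\<close>, defined on all series without reference to one of the two algebras.
\<close>

definition const_proj :: "'k::field_char_0 ser \<Rightarrow> 'k ser" where
  "const_proj f = taylor_const LY (taylor_const LX f)"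

lemma Phi_eq: "f \<in> alg k \<Longrightarrow> Phi k f = const_proj f"
  by (simp add: Phi_def total_expansion_iff total_coeff_def taylor_coeff_0 const_proj_def)


lemma graded_linear_const_proj: "graded_linear const_proj"
  using graded_linear_comp[OF graded_linear_taylor_const[of LY] graded_linear_taylor_const[of LX]]
  by (simp add: const_proj_def[abs_def])

interpretation const_proj: module_hom scale scale const_proj
  by (rule graded_linear_hom[OF graded_linear_const_proj])

lemma vanishes_at_const_proj: "vanishes_at n f \<Longrightarrow> vanishes_at n (const_proj f)"
  by (simp add: const_proj_def vanishes_at_taylor_const)

lemma const_proj_in_A0: "f \<in> alg k \<Longrightarrow> const_proj f \<in> A0 k"
  by (simp add: const_proj_def A0_def taylor_const_in_alg ser_deriv_taylor_const
    ser_deriv_taylor_other)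

lemma const_proj_eq_self: "f \<in> A0 k \<Longrightarrow> const_proj f = f"
  by (simp add: const_proj_def A0_def taylor_const_eq_self)

lemma A0_eq_image_const_proj: "(A0 k :: 'k::field_char_0 ser set) = const_proj ` alg k"
proof
  show "(A0 k :: 'k ser set) \<subseteq> const_proj ` alg k"
  proof
    fix f :: "'k ser" assume f: "f \<in> A0 k"
    then have "f \<in> alg k" by (simp add: A0_def)
    with const_proj_eq_self[OF f] show "f \<in> const_proj ` alg k"
      by (metis image_eqI)
  qed
qed (auto intro: const_proj_in_A0)


section \<open>A complement of the kernel of the projector\<close>

text \<open>
  Coefficients of \<open>L\<^sub>x h\<close> and \<open>L\<^sub>y g\<close> are indexed by monomials with first letter split off, so the
  support condition is needed in terms of what \<open>\<Gamma> \<union> {1}\<close> leaves out.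
\<close>

lemma mem_insert_None_Gamma_iff:
  "u \<in> insert None Gamma \<longleftrightarrow> (\<forall>v. u \<noteq> letter_mon LX \<odot> v) \<and>
     (\<forall>v. u = letter_mon LY \<odot> v \<longrightarrow> (\<exists>t. v = letter_mon LX \<odot> t))"
proof -
  have None_neq: "None \<noteq> letter_mon a \<odot> v" for a v by (cases v) auto
  have Leaf_eq: "letter_mon b = letter_mon a \<odot> v \<longleftrightarrow> a = b \<and> v = None" for a b v
    by (cases v) auto
  have Leaf_Gamma: "letter_mon b \<notin> Gamma" for b
  proof
    assume "letter_mon b \<in> Gamma"
    then have "deg (letter_mon b) \<ge> 2" unfolding Gamma_def by fastforce
    then show False by simp
  qed
  have Node_eq: "Some (Node p q) = letter_mon a \<odot> v \<longleftrightarrow> p = Leaf a \<and> v = Some q" for p q a v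
    by (cases v) auto
  have Node_Gamma: "Some (Node p q) \<in> Gamma \<longleftrightarrow>
      leaves p \<ge> 2 \<or> (p = Leaf LY \<and> (\<exists>t. Some q = letter_mon LX \<odot> t))" for p q
  proof -
    have "Some (Node p q) = s1 \<odot> s2 \<and> deg s1 \<ge> 2 \<and> deg s2 \<ge> 1 \<longleftrightarrow>
        s1 = Some p \<and> s2 = Some q \<and> leaves p \<ge> 2" for s1 s2
      by (cases "(s1, s2)" rule: mon_mult.cases) (auto simp: Suc_le_eq)
    moreover have "Some (Node p q) = letter_mon LY \<odot> (letter_mon LX \<odot> t) \<longleftrightarrow>
        p = Leaf LY \<and> Some q = letter_mon LX \<odot> t" for t
      unfolding Node_eq by auto
    ultimately show ?thesis by (simp add: Gamma_def)
  qed
  have leaves_Node: "leaves (Node p q) \<ge> 2" for p q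
    using leaves_pos[of p] leaves_pos[of q] by (simp del: leaves_pos)
  show ?thesis
  proof (cases u)
    case None
    then show ?thesis by (simp add: None_neq)
  next
    case (Some t)
    show ?thesis
    proof (cases t)
      case (Leaf b)
      then show ?thesis using Some Leaf Leaf_Gamma[of b]
        by (cases b) (auto simp: Leaf_eq None_neq
          simp del: mon_mult.simps)
    next
      case (Node p q)
      show ?thesis
      proof (cases p)
        case (Leaf b)
        then show ?thesis using Some Node
          by (cases b) (auto simp: Node_Gamma Node_eq
            simp del: mon_mult.simps)
      next
        case (Node p1 p2)
        then show ?thesis using Some \<open>t = Node p q\<close> leaves_Node[of p1 p2]
          by (auto simp: Node_Gamma Node_eq
            simp del: mon_mult.simps leaves.simps)
      qed
    qed
  qed
qed

text \<open>
  A series \<open>c\<close> killed by the projector is \<open>L\<^sub>x h + L\<^sub>y g\<close> with \<open>D\<^sub>x g = 0\<close>. If it is supported on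
  \<open>\<Gamma> \<union> {1}\<close>, then \<open>h = 0\<close>, and \<open>g\<close> has monomials \<open>x\<cdot>t\<close> only, so \<open>g = L\<^sub>x g'\<close>; but a nonzero multiple of
  \<open>x\<close> is not annihilated by \<open>D\<^sub>x\<close>.
\<close>

lemma const_proj_injective:
  assumes supp: "\<And>u. u \<notin> insert None Gamma \<Longrightarrow> c u = 0" and "const_proj c = 0"
  shows "c = 0"
proof -
  define h where "h = taylor_quot LX c"
  define g where "g = taylor_quot LY (taylor_const LX c)"
  have Dg: "ser_deriv LX g = 0"
    by (simp add: g_def ser_deriv_taylor_other ser_deriv_taylor_const)
  have c: "c = Lmul LX h + Lmul LY g"
  proof -
    have "taylor_const LX c = Lmul LY g"
      using assms(2) unfolding g_def const_proj_def taylor_const_def[of LY] by simp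
    moreover have "c = taylor_const LX c + Lmul LX h"
      unfolding h_def by (rule taylor_decomp)
    ultimately show ?thesis by (simp only: add.commute)
  qed
  have "h v = 0" for v
  proof -
    have "c (letter_mon LX \<odot> v) = 0"
      by (rule supp) (unfold mem_insert_None_Gamma_iff, blast)
    then show ?thesis by (simp add: c Lmul_at_letter)
  qed
  then have "h = 0" by (simp add: fun_eq_iff)
  define g' where "g' = (\<lambda>t. g (letter_mon LX \<odot> t))"
  have "Lmul LX g' = g"
  proof (rule Lmul_eqI)
    fix u assume "\<And>v. u \<noteq> letter_mon LX \<odot> v"
    then have "letter_mon LY \<odot> u \<notin> insert None Gamma"
      by (auto simp: mem_insert_None_Gamma_iff letter_mult_eq_iff simp del: insert_iff)
    then have "c (letter_mon LY \<odot> u) = 0" by (rule supp)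
    then show "g u = 0" by (simp add: c Lmul_at_letter)
  qed (simp add: g'_def)
  with Dg have "ser_deriv LX (Lmul LX g') = 0" by simp
  then have "g' = 0" by (rule ser_deriv_Lmul_eq_0)
  with \<open>Lmul LX g' = g\<close> have "g = 0" by simp
  with c \<open>h = 0\<close> show "c = 0" by simp
qed

text \<open>
  Subtract from \<open>f\<close> elements of the kernel of the projector until only monomials in \<open>\<Gamma> \<union> {1}\<close>
  remain: \<open>L\<^sub>x h\<close> removes all monomials \<open>x\<cdot>v\<close>, and if \<open>L\<^sub>y g\<close> is the part of \<open>f\<close> on the monomials \<open>y\<cdot>v\<close>,
  then removing \<open>L\<^sub>y\<close> of the remainder of \<open>g\<close> modulo \<open>x\<close> leaves only monomials \<open>y\<cdot>(x\<cdot>t)\<close> of it.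
\<close>

lemma const_proj_surjective:
  assumes "f \<in> A0 k"
  obtains c where "c \<in> alg k" "\<And>u. u \<notin> insert None Gamma \<Longrightarrow> c u = 0" "const_proj c = f"
proof
  define h where "h = (\<lambda>v. f (letter_mon LX \<odot> v))"
  define g where "g = (\<lambda>v. f (letter_mon LY \<odot> v))"
  define c where "c = f - Lmul LX h - Lmul LY (taylor_const LX g)"
  have "f \<in> alg k" using assms by (simp add: A0_def)
  then show "c \<in> alg k"
  proof (rule alg_if_vanishes_at)
    fix m assume f: "vanishes_at m f"
    have "vanishes_at m (Lmul LX h) \<and> vanishes_at m (Lmul LY (taylor_const LX g))"
    proof (cases m)
      case 0
      then show ?thesis by (simp add: vanishes_at_0_Lmul)
    next
      case (Suc n)
      with f have "vanishes_at n h" "vanishes_at n g"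
        by (auto simp: vanishes_at_def h_def g_def)
      with Suc show ?thesis by (simp add: vanishes_at_Lmul vanishes_at_taylor_const)
    qed
    with f show "vanishes_at m c" by (simp add: vanishes_at_def c_def)
  qed
  show "c u = 0" if u: "u \<notin> insert None Gamma" for u
  proof -
    from u consider v where "u = letter_mon LX \<odot> v"
      | v where "u = letter_mon LY \<odot> v" "\<And>t. v \<noteq> letter_mon LX \<odot> t"
      unfolding mem_insert_None_Gamma_iff by blast
    then show ?thesis
    proof cases
      case 1
      then show ?thesis by (simp add: c_def Lmul_at_letter h_def)
    next
      case 2
      \<comment> \<open>remainder and dividend differ by a multiple of \<open>x\<close>, which has no monomial \<open>v\<close>\<close>
      have "taylor_const LX g v = g v"
        using 2(2) by (simp add: taylor_const_def Lmul_at_other)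
      with 2(1) show ?thesis by (simp add: c_def Lmul_at_letter g_def)
    qed
  qed
  have "taylor_const LX (Lmul LY (taylor_const LX g)) = Lmul LY (taylor_const LX g)"
    by (rule taylor_const_eq_self) (simp add: ser_deriv_Lmul_other ser_deriv_taylor_const)
  then have "const_proj c = const_proj f"
    by (simp add: c_def const_proj.diff) (simp add: const_proj_def taylor_const_Lmul)
  then show "const_proj c = f" using assms by (simp add: const_proj_eq_self)
qed

section \<open>The basis\<close>

lemma span_mon_ser_support:
  assumes "f \<in> ser.span (mon_ser ` I)" "s \<notin> I"
  shows "f s = 0"
proof -
  have "ser.subspace {f. f s = 0}"
    by (simp add: ser.subspace_def scale_apply)
  moreover have "mon_ser ` I \<subseteq> {f. f s = 0}"
    using assms(2) by (auto simp: mon_ser_def)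
  ultimately have "ser.span (mon_ser ` I) \<subseteq> {f. f s = 0}"
    by (intro ser.span_minimal)
  with assms(1) show ?thesis by blast
qed

lemma span_mon_ser_if_support:
  assumes "f \<in> alg Free" "\<And>u. u \<notin> I \<Longrightarrow> f u = 0"
  shows "f \<in> ser.span (mon_ser ` I)"
proof -
  let ?S = "{u. f u \<noteq> 0}"
  have "finite ?S" using assms(1) by simp
  then have "f = (\<Sum>s\<in>?S. scale (f s) (mon_ser s))"
    by (auto simp: fun_eq_iff sum_ser_apply scale_apply mon_ser_def sum.delta
      if_distrib[of "\<lambda>x. f _ * x"] cong: if_cong)
  also have "\<dots> \<in> ser.span (mon_ser ` I)"
    using assms(2) by (intro ser.span_sum ser.span_scale ser.span_base) auto
  finally show ?thesis .
qed

lemma mon_ser_eq_iff: "mon_ser s = (mon_ser t :: 'k::field ser) \<longleftrightarrow> s = t"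
  by (auto simp: mon_ser_def fun_eq_iff split: if_splits)

lemma independent_mon_ser: "ser.independent (mon_ser ` I :: 'k::field ser set)"
proof
  assume "ser.dependent (mon_ser ` I :: 'k ser set)"
  then obtain s where s: "(mon_ser s :: 'k ser) \<in> ser.span (mon_ser ` I - {mon_ser s})"
    by (auto simp: ser.dependent_def)
  have "mon_ser ` I - {mon_ser s} = (mon_ser ` (I - {s}) :: 'k ser set)"
    by (auto simp: mon_ser_eq_iff)
  with s have "(mon_ser s :: 'k ser) s = 0"
    by (intro span_mon_ser_support[of _ "I - {s}"]) auto
  then show False by (simp add: mon_ser_def)
qed

lemma mon_ser_in_alg: "mon_ser s \<in> alg k"
  by (cases k) (simp_all add: mon_ser_def)

lemma subspace_alg_Free: "ser.subspace (alg Free)"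
proof (rule ser.subspaceI)
  show "f + g \<in> alg Free" if "f \<in> alg Free" "g \<in> alg Free" for f g :: "'a ser"
    using that by (auto intro: finite_subset[of _ "{u. f u \<noteq> 0} \<union> {u. g u \<noteq> 0}"])
  show "scale c f \<in> alg Free" if "f \<in> alg Free" for c and f :: "'a ser"
    using that by (auto simp: scale_apply)
qed simp

text \<open>
  Monomials are a basis of the finitely supported series on \<open>\<Gamma> \<union> {1}\<close>, on which the projector
  is injective with image \<open>A\<^sub>0\<close>.
\<close>

lemma is_basis_Free:
  "is_basis Free (insert None Gamma) (\<lambda>s. const_proj (mon_ser s))
     (A0 Free :: 'k::field_char_0 ser set)"
proof -
  let ?I = "insert None Gamma"
  let ?m = "mon_ser :: mon \<Rightarrow> 'k ser"
  have zero: "f = 0" if "f \<in> ser.span (?m ` ?I)" "const_proj f = 0" for f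
    using span_mon_ser_support[OF that(1)] that(2) by (rule const_proj_injective)
  have inj: "inj_on const_proj (ser.span (?m ` ?I))"
    using zero by (simp add: const_proj.inj_on_iff_eq_0 ser.subspace_span)
  have image: "(\<lambda>s. const_proj (?m s)) ` ?I = const_proj ` ?m ` ?I"
    by (simp only: image_image)
  have "inj_on (const_proj \<circ> ?m) ?I"
    by (intro comp_inj_on inj_on_subset[OF inj] ser.span_superset) (simp add: inj_on_def mon_ser_eq_iff)
  moreover have "ser.independent (const_proj ` ?m ` ?I)"
    by (rule const_proj.independent_injective_image[OF independent_mon_ser inj])
  moreover have "ser.span (const_proj ` ?m ` ?I) = A0 Free"
  proof (rule antisym)
    have "const_proj ` ?m ` ?I \<subseteq> A0 Free"
      by (auto intro!: const_proj_in_A0 mon_ser_in_alg)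
    moreover have "ser.subspace (A0 Free :: 'k ser set)"
    proof -
      have "ser.subspace ({f. ser_deriv LX f = 0} \<inter> {f. ser_deriv LY f = 0} \<inter> alg Free :: 'k ser set)"
        by (intro ser.subspace_inter ser_deriv.subspace_kernel subspace_alg_Free)
      moreover have "A0 Free = {f. ser_deriv LX f = 0} \<inter> {f. ser_deriv LY f = 0} \<inter> (alg Free :: 'k ser set)"
        unfolding A0_def by blast
      ultimately show ?thesis by (simp only:)
    qed
    ultimately show "ser.span (const_proj ` ?m ` ?I) \<subseteq> A0 Free"
      by (rule ser.span_minimal)
  next
    show "A0 Free \<subseteq> ser.span (const_proj ` ?m ` ?I)"
    proof
      fix f :: "'k ser" assume "f \<in> A0 Free"
      then obtain c where "c \<in> alg Free" "\<And>u. u \<notin> ?I \<Longrightarrow> c u = 0" "const_proj c = f"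
        by (rule const_proj_surjective) blast
      then have "f \<in> const_proj ` ser.span (?m ` ?I)"
        using span_mon_ser_if_support[of c ?I] by blast
      then show "f \<in> ser.span (const_proj ` ?m ` ?I)"
        by (simp only: const_proj.span_image)
    qed
  qed
  ultimately show ?thesis
    unfolding is_basis.simps image comp_def by (intro conjI)
qed

text \<open>
  By continuity, the infinite combination of the \<open>\<Phi>(s)\<close> with coefficients \<open>c\<close> is the projector
  applied to \<open>c\<close>, read as a series. So unique combinations mean bijectivity of the projector
  on series supported on \<open>\<Gamma> \<union> {1}\<close>.
\<close>

lemma is_basis_Completed:
  "is_basis Completed (insert None Gamma) (\<lambda>s. const_proj (mon_ser s))
     (A0 Completed :: 'k::field_char_0 ser set)"
  unfolding is_basis.simps
proof (intro conjI allI impI ballI)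
  fix c :: "'k ser"
  have "{s. scale (c s) (const_proj (mon_ser s)) u \<noteq> 0} \<subseteq> {s. deg s = deg u}" for u
  proof
    fix s assume "s \<in> {s. scale (c s) (const_proj (mon_ser s)) u \<noteq> 0}"
    then have "\<not> vanishes_at (deg u) (const_proj (mon_ser s) :: 'k ser)"
      by (auto simp: scale_apply dest: vanishes_atD)
    then have "\<not> vanishes_at (deg u) (mon_ser s :: 'k ser)"
      using vanishes_at_const_proj by blast
    then show "s \<in> {s. deg s = deg u}"
      by (auto simp: vanishes_at_def mon_ser_def split: if_splits)
  qed
  then have "finite {s. scale (c s) (const_proj (mon_ser s)) u \<noteq> 0}" for u
    by (rule finite_subset) (rule finite_deg_eq)
  then show "summable_in Completed (\<lambda>s. scale (c s) (const_proj (mon_ser s)))"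
    by simp
  show "ser_sum (\<lambda>s. scale (c s) (const_proj (mon_ser s))) \<in> A0 Completed"
    unfolding graded_linear_expand[OF graded_linear_const_proj, symmetric]
    by (rule const_proj_in_A0) simp
next
  fix f :: "'k ser" assume "f \<in> A0 Completed"
  then obtain c where c: "\<And>u. u \<notin> insert None Gamma \<Longrightarrow> c u = 0" "const_proj c = f"
    by (rule const_proj_surjective) blast
  show "\<exists>!c. (\<forall>s. s \<notin> insert None Gamma \<longrightarrow> c s = 0) \<and>
      f = ser_sum (\<lambda>s. scale (c s) (const_proj (mon_ser s)))"
    unfolding graded_linear_expand[OF graded_linear_const_proj, symmetric]
  proof (rule ex1I)
    show "(\<forall>s. s \<notin> insert None Gamma \<longrightarrow> c s = 0) \<and> f = const_proj c"
      using c by blast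
  next
    fix c' :: "'k ser"
    assume c': "(\<forall>s. s \<notin> insert None Gamma \<longrightarrow> c' s = 0) \<and> f = const_proj c'"
    have "c' - c = 0"
    proof (rule const_proj_injective)
      show "(c' - c) u = 0" if "u \<notin> insert None Gamma" for u
        using that c' c by simp
      show "const_proj (c' - c) = 0" using c' c(2) by (simp add: const_proj.diff)
    qed
    then show "c' = c" by simp
  qed
qed

theorem proposition3p3:
  fixes k :: kind
  shows "A0 k = (Phi k ` alg k :: 'k::field_char_0 ser set) \<and>
         A0 k = ((partial_Phi k LY \<circ> partial_Phi k LX) ` alg k :: 'k ser set) \<and>
         is_basis k (insert None Gamma) (\<lambda>s. Phi k (mon_ser s)) (A0 k :: 'k ser set)"
proof (intro conjI)
  show "A0 k = (Phi k ` alg k :: 'k ser set)"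
    unfolding A0_eq_image_const_proj by (intro image_cong refl) (simp add: Phi_eq)
  show "A0 k = ((partial_Phi k LY \<circ> partial_Phi k LX) ` alg k :: 'k ser set)"
    unfolding A0_eq_image_const_proj
    by (intro image_cong refl) (simp add: partial_Phi_eq taylor_const_in_alg const_proj_def)
  have "(\<lambda>s. Phi k (mon_ser s)) = (\<lambda>s. const_proj (mon_ser s :: 'k ser))"
    by (simp add: Phi_eq mon_ser_in_alg)
  then show "is_basis k (insert None Gamma) (\<lambda>s. Phi k (mon_ser s)) (A0 k :: 'k ser set)"
    by (cases k) (simp_all only: is_basis_Free is_basis_Completed)
qed

end
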